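(* Let $N$ be a normal subgroup of a group $G$ with an HNN decomposition $G = A\ast_C = \langle A, t : tCt^{-1} = D\rangle$. (1) If $N$ is finitely generated and $N \not\subseteq C$, then $NC$ is of finite index in $G$; and if moreover $N \cap C$ is finitely generated, then $N \cap A$ is finitely generated. (2) Conversely, if $NC$ is of finite index in $G$, then $N \not\subseteq C$; and if moreover $N \cap A$ is finitely generated, then $N$ is finitely generated. (3) If $NC$ is of finite index in $G$, then $G/N$ is finite if and only if $C/(N \cap C)$ is finite.
   Context: $G = A\ast_C = \langle A,t : tCt^{-1} = D\rangle$ denotes the HNN extension of the group $A$ with stable letter $t$ and associated subgroups $C, D \leq A$, where conjugation by $t$ realizes a given isomorphism $C \to D$; $A$, $C$ and $D$ are regarded as subgroups of $G$. *)

theory Defs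
  imports "HOL-Algebra.Generated_Groups"
begin

section \<open>HNN extensions\<close>

text \<open>
  The HNN extension \<open>\<langle>K, t : t c t\<^sup>-\<^sup>1 = \<phi> c (c \<in> C)\<rangle>\<close> is the monoid of words over the elements
  of \<open>K\<close> and the letters \<open>t\<close>, \<open>t\<^sup>-\<^sup>1\<close>, modulo the smallest congruence containing the multiplication
  table of \<open>K\<close>, the relations making \<open>t\<close> and \<open>t\<^sup>-\<^sup>1\<close> mutually inverse, and \<open>t c t\<^sup>-\<^sup>1 = \<phi> c\<close>.
  Inverses of letters are words, so the quotient is the group with this presentation.
\<close>

datatype 'a hnn_letter = Base 'a | Stable | Stable_inv

definition hnn_words :: "('a, 'b) monoid_scheme \<Rightarrow> 'a hnn_letter list set"
  where "hnn_words K = lists (Base ` carrier K \<union> {Stable, Stable_inv})"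

inductive hnn_eq ::
  "('a, 'b) monoid_scheme \<Rightarrow> 'a set \<Rightarrow> ('a \<Rightarrow> 'a) \<Rightarrow> 'a hnn_letter list \<Rightarrow> 'a hnn_letter list \<Rightarrow> bool"
  for K (structure) and C \<phi>
where
  refl: "w \<in> hnn_words K \<Longrightarrow> hnn_eq K C \<phi> w w"
| sym: "hnn_eq K C \<phi> u v \<Longrightarrow> hnn_eq K C \<phi> v u"
| trans: "hnn_eq K C \<phi> u v \<Longrightarrow> hnn_eq K C \<phi> v w \<Longrightarrow> hnn_eq K C \<phi> u w"
| append: "hnn_eq K C \<phi> u u' \<Longrightarrow> hnn_eq K C \<phi> v v' \<Longrightarrow> hnn_eq K C \<phi> (u @ v) (u' @ v')"
| base_one: "hnn_eq K C \<phi> [Base \<one>] []"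
| base_mult: "a \<in> carrier K \<Longrightarrow> b \<in> carrier K \<Longrightarrow> hnn_eq K C \<phi> [Base a, Base b] [Base (a \<otimes> b)]"
| stable_r_inv: "hnn_eq K C \<phi> [Stable, Stable_inv] []"
| stable_l_inv: "hnn_eq K C \<phi> [Stable_inv, Stable] []"
| conj: "c \<in> C \<Longrightarrow> hnn_eq K C \<phi> [Stable, Base c, Stable_inv] [Base (\<phi> c)]"

definition hnn_class ::
  "('a, 'b) monoid_scheme \<Rightarrow> 'a set \<Rightarrow> ('a \<Rightarrow> 'a) \<Rightarrow> 'a hnn_letter list \<Rightarrow> 'a hnn_letter list set"
  where "hnn_class K C \<phi> w = {w'. hnn_eq K C \<phi> w w'}"

definition hnn_extension ::
  "('a, 'b) monoid_scheme \<Rightarrow> 'a set \<Rightarrow> ('a \<Rightarrow> 'a) \<Rightarrow> 'a hnn_letter list set monoid"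
  where "hnn_extension K C \<phi> =
    \<lparr>carrier = hnn_class K C \<phi> ` hnn_words K,
     monoid.mult = (\<lambda>U V. \<Union>u\<in>U. \<Union>v\<in>V. hnn_class K C \<phi> (u @ v)),
     one = hnn_class K C \<phi> []\<rparr>"

lemma hnn_class_eq_iff:
  assumes "u \<in> hnn_words K"
  shows "hnn_class K C \<phi> u = hnn_class K C \<phi> v \<longleftrightarrow> hnn_eq K C \<phi> u v"
proof
  assume "hnn_class K C \<phi> u = hnn_class K C \<phi> v"
  moreover have "u \<in> hnn_class K C \<phi> u"
    using assms by (simp add: hnn_class_def hnn_eq.refl)
  ultimately have "u \<in> hnn_class K C \<phi> v" by simp
  then show "hnn_eq K C \<phi> u v" by (simp add: hnn_class_def hnn_eq.sym)
next
  assume "hnn_eq K C \<phi> u v"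
  then have "hnn_eq K C \<phi> u w \<longleftrightarrow> hnn_eq K C \<phi> v w" for w
    using hnn_eq.sym hnn_eq.trans by metis
  then show "hnn_class K C \<phi> u = hnn_class K C \<phi> v" by (simp add: hnn_class_def)
qed

lemma hnn_class_mult:
  assumes "u \<in> hnn_words K" "v \<in> hnn_words K"
  shows "hnn_class K C \<phi> u \<otimes>\<^bsub>hnn_extension K C \<phi>\<^esub> hnn_class K C \<phi> v = hnn_class K C \<phi> (u @ v)"
proof -
  have *: "hnn_class K C \<phi> (u' @ v') = hnn_class K C \<phi> (u @ v)"
    if "u' \<in> hnn_class K C \<phi> u" "v' \<in> hnn_class K C \<phi> v" for u' v'
  proof -
    have "hnn_eq K C \<phi> (u @ v) (u' @ v')"
      using that by (simp add: hnn_class_def hnn_eq.append)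
    moreover have "u @ v \<in> hnn_words K"
      using assms by (simp add: hnn_words_def)
    ultimately show ?thesis
      using hnn_class_eq_iff[of "u @ v" K C \<phi> "u' @ v'"] by simp
  qed
  have "u \<in> hnn_class K C \<phi> u" "v \<in> hnn_class K C \<phi> v"
    using assms by (simp_all add: hnn_class_def hnn_eq.refl)
  then have "(\<Union>u'\<in>hnn_class K C \<phi> u. \<Union>v'\<in>hnn_class K C \<phi> v. hnn_class K C \<phi> (u' @ v'))
      = hnn_class K C \<phi> (u @ v)"
    using * by blast
  then show ?thesis
    by (simp add: hnn_extension_def)
qed

lemma hnn_word_inverse:
  assumes "group K" "w \<in> hnn_words K"
  shows "\<exists>w' \<in> hnn_words K. hnn_eq K C \<phi> (w' @ w) []"
  using assms(2) unfolding hnn_words_def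
proof (induction w rule: lists.induct)
  case Nil
  show ?case by (rule bexI[of _ "[]"]) (simp_all add: hnn_words_def hnn_eq.refl)
next
  case (Cons x w)
  then obtain w' where w': "w' \<in> hnn_words K" "hnn_eq K C \<phi> (w' @ w) []"
    unfolding hnn_words_def by blast
  have w: "w \<in> hnn_words K" using Cons by (simp add: hnn_words_def)
  interpret group K by fact
  have "\<exists>y. [y] \<in> hnn_words K \<and> hnn_eq K C \<phi> [y, x] []"
  proof (cases x)
    case (Base a)
    then have a: "a \<in> carrier K" using Cons by auto
    have "hnn_eq K C \<phi> [Base (inv\<^bsub>K\<^esub> a), Base a] []"
      using hnn_eq.base_mult[of "inv\<^bsub>K\<^esub> a" K a C \<phi>] a
      by (intro hnn_eq.trans[OF _ hnn_eq.base_one]) simp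
    then show ?thesis using Base a by (intro exI[of _ "Base (inv\<^bsub>K\<^esub> a)"]) (simp add: hnn_words_def)
  next
    case Stable
    then show ?thesis by (intro exI[of _ Stable_inv]) (simp add: hnn_words_def hnn_eq.stable_l_inv)
  next
    case Stable_inv
    then show ?thesis by (intro exI[of _ Stable]) (simp add: hnn_words_def hnn_eq.stable_r_inv)
  qed
  then obtain y where y: "[y] \<in> hnn_words K" "hnn_eq K C \<phi> [y, x] []" by blast
  have "hnn_eq K C \<phi> (w' @ ([y, x] @ w)) (w' @ ([] @ w))"
    by (rule hnn_eq.append[OF hnn_eq.refl[OF w'(1)] hnn_eq.append[OF y(2) hnn_eq.refl[OF w]]])
  then have "hnn_eq K C \<phi> ((w' @ [y]) @ (x # w)) (w' @ w)" by simp
  then have "hnn_eq K C \<phi> ((w' @ [y]) @ (x # w)) []"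
    using w'(2) by (rule hnn_eq.trans)
  moreover have "w' @ [y] \<in> hnn_words K" using w' y by (simp add: hnn_words_def)
  ultimately show ?case unfolding hnn_words_def by (rule bexI)
qed

lemma hnn_extension_group:
  assumes "group K"
  shows "group (hnn_extension K C \<phi>)"
proof (rule groupI)
  let ?H = "hnn_extension K C \<phi>"
  have carr: "carrier ?H = hnn_class K C \<phi> ` hnn_words K"
    and one: "\<one>\<^bsub>?H\<^esub> = hnn_class K C \<phi> []"
    by (simp_all add: hnn_extension_def)
  have app: "u @ v \<in> hnn_words K" if "u \<in> hnn_words K" "v \<in> hnn_words K" for u v
    using that by (simp add: hnn_words_def)
  have nil: "[] \<in> hnn_words K" by (simp add: hnn_words_def)
  show "\<one>\<^bsub>?H\<^esub> \<in> carrier ?H" using carr one nil by simp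
  fix x assume x: "x \<in> carrier ?H"
  then obtain u where u: "u \<in> hnn_words K" "x = hnn_class K C \<phi> u" using carr by auto
  show "\<one>\<^bsub>?H\<^esub> \<otimes>\<^bsub>?H\<^esub> x = x" using u nil by (simp add: one hnn_class_mult)
  obtain u' where u': "u' \<in> hnn_words K" "hnn_eq K C \<phi> (u' @ u) []"
    using hnn_word_inverse[OF assms u(1)] by blast
  then have "hnn_class K C \<phi> u' \<otimes>\<^bsub>?H\<^esub> x = \<one>\<^bsub>?H\<^esub>"
    using u app by (simp add: one hnn_class_mult hnn_class_eq_iff)
  then show "\<exists>y\<in>carrier ?H. y \<otimes>\<^bsub>?H\<^esub> x = \<one>\<^bsub>?H\<^esub>" using u' carr by auto
  fix y assume "y \<in> carrier ?H"
  then obtain v where v: "v \<in> hnn_words K" "y = hnn_class K C \<phi> v" using carr by auto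
  show "x \<otimes>\<^bsub>?H\<^esub> y \<in> carrier ?H" using u v app carr by (simp add: hnn_class_mult)
  fix z assume "z \<in> carrier ?H"
  then obtain w where w: "w \<in> hnn_words K" "z = hnn_class K C \<phi> w" using carr by auto
  show "x \<otimes>\<^bsub>?H\<^esub> y \<otimes>\<^bsub>?H\<^esub> z = x \<otimes>\<^bsub>?H\<^esub> (y \<otimes>\<^bsub>?H\<^esub> z)"
    using u v w app by (simp add: hnn_class_mult)
qed

text \<open>
  An HNN decomposition \<open>G = \<langle>A, t : t C t\<^sup>-\<^sup>1 = D\<rangle>\<close> with \<open>A\<close>, \<open>C\<close>, \<open>D\<close> regarded as subgroups of \<open>G\<close>:
  the abstract HNN extension is isomorphic to \<open>G\<close> by an isomorphism that is the inclusion on \<open>A\<close>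
  and sends the stable letter to \<open>t\<close>. In particular conjugation by \<open>t\<close> restricts to
  \<open>\<phi> : C \<rightarrow> D\<close>.
\<close>

locale hnn_decomposition = group G for G (structure) +
  fixes A C D :: "'a set" and \<phi> :: "'a \<Rightarrow> 'a" and t :: 'a
  assumes subgroup_A: "subgroup A G"
    and subgroup_C: "subgroup C (G\<lparr>carrier := A\<rparr>)"
    and subgroup_D: "subgroup D (G\<lparr>carrier := A\<rparr>)"
    and iso_C_D: "\<phi> \<in> iso (G\<lparr>carrier := C\<rparr>) (G\<lparr>carrier := D\<rparr>)"
    and iso_hnn_extension:
      "\<exists>h \<in> iso (hnn_extension (G\<lparr>carrier := A\<rparr>) C \<phi>) G.
         (\<forall>a\<in>A. h (hnn_class (G\<lparr>carrier := A\<rparr>) C \<phi> [Base a]) = a) \<and>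
         h (hnn_class (G\<lparr>carrier := A\<rparr>) C \<phi> [Stable]) = t"

section \<open>Finiteness conditions\<close>

definition finitely_generated :: "('a, 'b) monoid_scheme \<Rightarrow> bool"
  where "finitely_generated G \<longleftrightarrow>
    (\<exists>S. finite S \<and> S \<subseteq> carrier G \<and> generate G S = carrier G)"

definition finite_index :: "('a, 'b) monoid_scheme \<Rightarrow> 'a set \<Rightarrow> bool"
  where "finite_index G H \<longleftrightarrow> subgroup H G \<and> finite (rcosets\<^bsub>G\<^esub> H)"

end

theory Submission
  imports Defs "HOL-Algebra.SndIsomorphismGrp"
begin

text \<open>
  Let \<open>T\<close> be the Bass--Serre tree of the decomposition: its vertices are the cosets \<open>gA\<close>, its edges
  the cosets \<open>gC\<close>, and \<open>gC\<close> joins \<open>gA\<close> to \<open>gt\<^sup>-\<^sup>1A\<close>. The group \<open>G\<close> permutes the edges transitively, so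
  the edges of \<open>N\T\<close> correspond to the cosets of \<open>NC\<close>, and \<open>NC\<close> has finite index if and only if
  \<open>N\T\<close> is finite. The tree itself is not constructed. Its two essential properties are replaced as
  follows. That it is connected becomes the fact that \<open>G\<close> is generated by \<open>A\<close> and \<open>t\<close>. That it has no
  circuits becomes the universal property of the presentation: a set on which \<open>A\<close> acts, together with
  a permutation that satisfies the relations for \<open>t\<close>, is a right \<open>G\<close>-set (\<open>right_action\<close>). Normal
  forms are not needed.

  Finite index of \<open>NC\<close>. On \<open>G \<times> {\<plusminus>}\<close> let \<open>A\<close> act by right multiplication and let \<open>t\<^sup>-\<^sup>1\<close> in addition
  flip the sign at the elements of \<open>C\<close>. The orbit of \<open>(1, +)\<close> is the graph of a function \<open>\<chi>\<close> that tells
  on which side of the edge \<open>C\<close> the vertex \<open>gA\<close> lies (\<open>side_function\<close>). Let \<open>K\<close> be the set of all \<open>k\<close>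
  for which the edge \<open>k\<^sup>-\<^sup>1C\<close> separates two vertices in the \<open>N\<close>-orbit of \<open>A\<close>. If \<open>N\<close> is finitely
  generated, then \<open>K\<close> consists of finitely many cosets of \<open>NC\<close>. Replacing the vertex \<open>A\<close> by its
  neighbour \<open>t\<^sup>-\<^sup>1A\<close> replaces \<open>K\<close> by \<open>Kt\<close>, as \<open>N\<close> is normal, and can change \<open>K\<close> only in the coset \<open>NC\<close>
  itself. As \<open>K\<close> and \<open>Kt\<close> contain equally many cosets, they are equal. So \<open>K\<close> is invariant under
  \<open>A\<close> and \<open>t\<close>, hence it is empty or all of \<open>G\<close>. In the first case \<open>N\<close> fixes the edge \<open>C\<close>, in the second
  \<open>NC\<close> has finite index.

  Generators of \<open>N \<inter> A\<close>. For a subgroup \<open>P\<close> of \<open>N \<inter> A\<close> the group \<open>G\<close> acts on the disjoint union of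
  \<open>P\G\<close> and \<open>N\G\<close> as follows: \<open>A\<close> acts by translation, and \<open>t\<^sup>-\<^sup>1\<close> acts by translation preceded and
  followed by involutions that interchange \<open>Pa\<close> and \<open>Na\<close> for certain \<open>a \<in> A\<close> (\<open>exchange_action\<close>). These
  involutions exist if \<open>P\<close> contains finitely many conjugates of \<open>N \<inter> C\<close>. Each \<open>g\<close> in \<open>N\<close> fixes the
  point \<open>P\<close> as soon as \<open>P\<close> contains a finite set depending on \<open>g\<close> (\<open>trajectory\<close>). Hence there is a
  finitely generated \<open>P\<close> such that the point \<open>P\<close> is fixed by generators of \<open>N\<close>, so by all of
  \<open>N\<close>. But \<open>N \<inter> A\<close> moves the point \<open>P\<close> by translation; therefore \<open>P = N \<inter> A\<close>.

  In the converse direction, \<open>N \<subseteq> C\<close> would make \<open>C\<close> a subgroup of finite index, contrary to the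
  homomorphism to \<open>\<int>\<close> that kills \<open>A\<close> and not \<open>t\<close>; and \<open>N\<close> is generated by finitely many vertex
  stabilizers, which are conjugates of \<open>N \<inter> A\<close>, together with finitely many elements that identify
  vertices of a finite set of representatives. The statement on quotients follows from
  \<open>NC/N \<cong> C/(N \<inter> C)\<close>.
\<close>

section \<open>Cosets and generation\<close>

lemma (in group) inv_mult_cancel [simp]:
  assumes "x \<in> carrier G" "y \<in> carrier G"
  shows "inv x \<otimes> (x \<otimes> y) = y" "x \<otimes> (inv x \<otimes> y) = y"
  using assms by (simp_all flip: m_assoc)

lemma (in group) r_coset_eq_iff:
  assumes "subgroup H G" "a \<in> carrier G" "b \<in> carrier G"
  shows "H #> a = H #> b \<longleftrightarrow> a \<otimes> inv b \<in> H"
proof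
  interpret subgroup H G by fact
  assume "H #> a = H #> b"
  then have "a \<in> H #> b"
    using rcos_self[OF assms(2,1)] by simp
  then show "a \<otimes> inv b \<in> H"
    using assms by (auto simp: r_coset_def m_assoc)
next
  interpret subgroup H G by fact
  assume "a \<otimes> inv b \<in> H"
  then have "a \<in> H #> b"
    using rcos_module_rev[OF group_axioms assms(3,2)] by simp
  then show "H #> a = H #> b"
    using repr_independence assms by metis
qed

lemma (in group) finite_rcosetsE:
  assumes "finite (rcosets H)"
  obtains F where "finite F" "F \<subseteq> carrier G" "\<forall>g\<in>carrier G. \<exists>f\<in>F. H #> g = H #> f"
proof -
  have eq: "rcosets H = (\<lambda>g. H #> g) ` carrier G"
    by (auto simp: RCOSETS_def)
  obtain F where F: "F \<subseteq> carrier G" "finite F" "rcosets H = (\<lambda>g. H #> g) ` F"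
    using finite_subset_image[OF assms, of "\<lambda>g. H #> g" "carrier G"] eq by auto
  have "(\<lambda>g. H #> g) ` carrier G = (\<lambda>g. H #> g) ` F"
    using F(3) eq by simp
  then have "\<forall>g\<in>carrier G. \<exists>f\<in>F. H #> g = H #> f"
    by (metis (no_types, lifting) imageE imageI)
  with F(2,1) show thesis
    by (rule that)
qed

lemma (in group) finite_rcosetsI:
  assumes "finite F" "\<And>g. g \<in> carrier G \<Longrightarrow> \<exists>f\<in>F. H #> g = H #> f"
  shows "finite (rcosets H)"
proof (rule finite_subset)
  show "rcosets H \<subseteq> (\<lambda>g. H #> g) ` F"
    using assms(2) by (auto simp: RCOSETS_def)
qed (simp add: assms)

lemma (in group) finitely_generated_subgroup_iff:
  assumes "subgroup H G"
  shows "finitely_generated (G\<lparr>carrier := H\<rparr>) \<longleftrightarrow> (\<exists>S. finite S \<and> S \<subseteq> H \<and> generate G S = H)"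
  using generate_consistent[OF _ assms] unfolding finitely_generated_def by auto

lemma (in group) generate_conjugate:
  assumes "S \<subseteq> carrier G" "g \<in> carrier G" "subgroup P G"
    and "\<And>s. s \<in> S \<Longrightarrow> g \<otimes> s \<otimes> inv g \<in> P"
    and "x \<in> generate G S"
  shows "g \<otimes> x \<otimes> inv g \<in> P"
  using assms(5)
proof (induction rule: generate.induct)
  case one
  then show ?case using assms(2) subgroup.one_closed[OF assms(3)] by simp
next
  case (incl h)
  then show ?case using assms(4) by simp
next
  case (inv h)
  then have "h \<in> carrier G" using assms(1) by blast
  moreover have "inv (g \<otimes> h \<otimes> inv g) \<in> P"
    using assms(4)[OF inv] subgroup.m_inv_closed[OF assms(3)] by blast
  ultimately show ?case
    using assms(2) by (simp add: inv_mult_group m_assoc)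
next
  case (eng h1 h2)
  then have "h1 \<in> carrier G" "h2 \<in> carrier G"
    using generate_in_carrier[OF assms(1)] by auto
  moreover have "(g \<otimes> h1 \<otimes> inv g) \<otimes> (g \<otimes> h2 \<otimes> inv g) \<in> P"
    using eng subgroup.m_closed[OF assms(3)] by blast
  ultimately show ?case
    using assms(2) by (simp add: m_assoc)
qed

lemma (in group) mem_set_multE:
  assumes "x \<in> H <#> K"
  obtains h k where "h \<in> H" "k \<in> K" "x = h \<otimes> k"
  using assms by (auto simp: set_mult_def)

lemma (in group) mem_set_multI:
  "h \<in> H \<Longrightarrow> k \<in> K \<Longrightarrow> h \<otimes> k \<in> H <#> K"
  by (auto simp: set_mult_def)

lemma (in group) finite_index_set_multE:
  assumes "finite_index G (N <#> B)" "N \<lhd> G" "subgroup B G"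
  obtains Q where "finite Q" "Q \<subseteq> carrier G"
    "\<forall>g\<in>carrier G. \<exists>n\<in>N. \<exists>q\<in>Q. \<exists>b\<in>B. g = n \<otimes> q \<otimes> b"
proof -
  interpret N: normal N G by fact
  interpret B: subgroup B G by fact
  have H: "subgroup (N <#> B) G" and "finite (rcosets (N <#> B))"
    using assms(1) by (auto simp: finite_index_def)
  obtain F where F: "finite F" "F \<subseteq> carrier G"
    "\<forall>g\<in>carrier G. \<exists>f\<in>F. (N <#> B) #> g = (N <#> B) #> f"
    by (rule finite_rcosetsE[OF \<open>finite (rcosets (N <#> B))\<close>])
  have "\<exists>n\<in>N. \<exists>q\<in>(\<lambda>f. inv f) ` F. \<exists>b\<in>B. g = n \<otimes> q \<otimes> b" if g: "g \<in> carrier G" for g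
  proof -
    obtain f where f: "f \<in> F" "(N <#> B) #> inv g = (N <#> B) #> f"
      using bspec[OF F(3), of "inv g"] g by auto
    then have fc: "f \<in> carrier G" using F(2) by blast
    have "inv g \<otimes> inv f \<in> N <#> B"
      using r_coset_eq_iff[OF H, of "inv g" f] f(2) fc g by simp
    then obtain n b where nb: "n \<in> N" "b \<in> B" "inv g \<otimes> inv f = n \<otimes> b" by (rule mem_set_multE)
    then have nbc: "n \<in> carrier G" "b \<in> carrier G" by auto
    have "inv g = n \<otimes> b \<otimes> f"
      using nb(3) g fc nbc by (simp add: inv_solve_right')
    then have "g = inv (n \<otimes> b \<otimes> f)"
      using g by (metis inv_inv)
    then have "g = (inv (b \<otimes> f) \<otimes> inv n \<otimes> (b \<otimes> f)) \<otimes> inv f \<otimes> inv b"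
      using nbc fc by (simp add: inv_mult_group m_assoc)
    moreover have "inv (b \<otimes> f) \<otimes> inv n \<otimes> (b \<otimes> f) \<in> N"
      using nb fc by (intro N.inv_op_closed1) auto
    ultimately show ?thesis
      using f(1) nb(2) B.m_inv_closed by blast
  qed
  then show thesis
    using F(1,2) by (intro that[of "(\<lambda>f. inv f) ` F"]) auto
qed

text \<open>
  If a set \<open>K\<close> of finitely many right cosets of \<open>H\<close> and its translate \<open>Kt\<close> agree outside \<open>H\<close>, then
  they contain equally many cosets and so agree on \<open>H\<close> as well.
\<close>

lemma (in group) translate_eq_if_agree_off_subgroup:
  assumes H: "subgroup H G" and K: "K \<subseteq> carrier G" "\<And>h k. \<lbrakk>h \<in> H; k \<in> K\<rbrakk> \<Longrightarrow> h \<otimes> k \<in> K"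
    and fin: "finite ((\<lambda>k. H #> k) ` K)" and t: "t \<in> carrier G"
    and agree: "\<And>k. \<lbrakk>k \<in> carrier G; k \<notin> H\<rbrakk> \<Longrightarrow> k \<in> K \<longleftrightarrow> k \<otimes> inv t \<in> K"
    and k: "k \<in> carrier G"
  shows "k \<in> K \<longleftrightarrow> k \<otimes> inv t \<in> K"
proof -
  interpret H: subgroup H G by fact
  let ?Q = "(\<lambda>k. H #> k) ` K"
  let ?R = "(\<lambda>k. H #> k \<otimes> t) ` K"
  have "?R = (\<lambda>X. X #> t) ` ?Q"
    unfolding image_image using K(1) t by (intro image_cong) (auto simp: coset_mult_assoc H.subset)
  moreover have "inj_on (\<lambda>X. X #> t) ?Q"
  proof (rule inj_onI)
    fix X Y assume "X \<in> ?Q" "Y \<in> ?Q" and eq: "X #> t = Y #> t"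
    then have "X \<subseteq> carrier G" "Y \<subseteq> carrier G"
      using K(1) r_coset_subset_G[OF H.subset] by blast+
    then have "X = X #> t #> inv t" "Y = Y #> t #> inv t"
      using t by (simp_all add: coset_mult_assoc)
    then show "X = Y" using eq by simp
  qed
  ultimately have card: "card ?R = card ?Q" "finite ?R"
    using fin by (simp_all add: card_image)
  have coset_in_H: "H #> \<one> \<noteq> H #> x" if "x \<in> carrier G" "x \<notin> H" for x
    using that rcos_self[OF that(1) H] H.subset by (metis coset_mult_one)
  have psub: "U \<subset> V" if "U \<subseteq> V - {X}" "X \<in> V" for U V and X :: "'a set"
    using that by blast
  have "\<one> \<in> K \<longleftrightarrow> inv t \<in> K"
  proof (rule ccontr)
    assume neq: "\<not> ?thesis"
    show False
    proof (cases "\<one> \<in> K")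
      case True
      have not_H: "x \<otimes> t \<notin> H" if "x \<in> K" for x
      proof
        assume "x \<otimes> t \<in> H"
        then have "inv (x \<otimes> t) \<otimes> x \<in> K"
          by (intro K(2) H.m_inv_closed that)
        moreover have "x \<in> carrier G" using that K(1) by blast
        ultimately have "inv t \<in> K"
          using t by (simp add: inv_mult_group m_assoc)
        then show False using neq True by simp
      qed
      have "?R \<subseteq> ?Q - {H #> \<one>}"
      proof
        fix X assume "X \<in> ?R"
        then obtain x where x: "x \<in> K" "X = H #> x \<otimes> t" by blast
        then have xc: "x \<in> carrier G" using K(1) by blast
        have "x \<otimes> t \<in> K"
          using agree[of "x \<otimes> t"] not_H[OF x(1)] xc t x(1) by (simp add: m_assoc)
        moreover have "X \<noteq> H #> \<one>"
          using x(2) coset_in_H[of "x \<otimes> t"] not_H[OF x(1)] xc t by simp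
        ultimately show "X \<in> ?Q - {H #> \<one>}"
          using x(2) by simp
      qed
      moreover have "H #> \<one> \<in> ?Q" using True by (rule imageI)
      ultimately have "?R \<subset> ?Q" by (rule psub)
      from psubset_card_mono[OF fin this] show False
        unfolding card(1) by simp
    next
      case False
      then have not_H: "x \<notin> H" if "x \<in> K" for x
      proof -
        have "x \<in> carrier G" using that K(1) by blast
        moreover have "inv x \<otimes> x \<in> K" if "x \<in> H"
          by (intro K(2) H.m_inv_closed that \<open>x \<in> K\<close>)
        ultimately show ?thesis using False by auto
      qed
      have "?Q \<subseteq> ?R - {H #> \<one>}"
      proof
        fix X assume "X \<in> ?Q"
        then obtain x where x: "x \<in> K" "X = H #> x" by blast
        then have xc: "x \<in> carrier G" using K(1) by blast
        have "x \<otimes> inv t \<in> K"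
          using agree[OF xc not_H[OF x(1)]] x(1) by simp
        moreover have "x = (x \<otimes> inv t) \<otimes> t"
          using xc t by (simp add: m_assoc)
        then have "X = H #> (x \<otimes> inv t) \<otimes> t"
          using x(2) by simp
        ultimately have "X \<in> ?R"
          by (rule image_eqI[rotated])
        moreover have "X \<noteq> H #> \<one>"
          using x(2) coset_in_H[of x] not_H[OF x(1)] xc by simp
        ultimately show "X \<in> ?R - {H #> \<one>}"
          by simp
      qed
      moreover have "inv t \<in> K" using neq False by simp
      then have "H #> inv t \<otimes> t \<in> ?R"
        by (rule imageI)
      then have "H #> \<one> \<in> ?R"
        using t by simp
      ultimately have "?Q \<subset> ?R" by (rule psub)
      from psubset_card_mono[OF card(2) this] show False
        unfolding card(1) by simp
    qed
  qed
  moreover have "h \<otimes> x \<in> K \<longleftrightarrow> x \<in> K" if "h \<in> H" "x \<in> carrier G" for h x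
    using K(2)[OF that(1), of x] K(2)[OF H.m_inv_closed[OF that(1)], of "h \<otimes> x"] that by fastforce
  from this[of k \<one>] this[of k "inv t"]
  have "k \<in> K \<longleftrightarrow> \<one> \<in> K" "k \<otimes> inv t \<in> K \<longleftrightarrow> inv t \<in> K" if "k \<in> H"
    using that k t by simp_all
  ultimately show ?thesis
    using agree[OF k] by argo
qed

lemma finite_image_if_coarser:
  assumes "\<And>c d. \<lbrakk>c \<in> C; d \<in> C; f c = f d\<rbrakk> \<Longrightarrow> g c = g d" "finite (f ` C)"
  shows "finite (g ` C)"
proof (rule finite_subset)
  show "g ` C \<subseteq> (\<lambda>X. g (inv_into C f X)) ` f ` C"
  proof
    fix X assume "X \<in> g ` C"
    then obtain c where c: "c \<in> C" "X = g c" by blast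
    then have "g (inv_into C f (f c)) = g c"
      by (intro assms(1)) (auto simp: inv_into_into f_inv_into_f)
    then show "X \<in> (\<lambda>X. g (inv_into C f X)) ` f ` C"
      using c by force
  qed
qed (use assms(2) in simp)

section \<open>Right actions of an HNN extension\<close>

lemma (in hnn_decomposition) subgroups:
  shows "C \<subseteq> A" "D \<subseteq> A" "A \<subseteq> carrier G" "subgroup C G" "subgroup D G"
  using subgroup.subset[OF subgroup_C] subgroup.subset[OF subgroup_D]
    subgroup.subset[OF subgroup_A] incl_subgroup[OF subgroup_A subgroup_C]
    incl_subgroup[OF subgroup_A subgroup_D]
  by auto

primrec (in hnn_decomposition) letter_value :: "'a hnn_letter \<Rightarrow> 'a" where
  "letter_value (Base a) = a"
| "letter_value Stable = t"
| "letter_value Stable_inv = inv t"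

text \<open>
  The element of \<open>G\<close> represented by a word in \<open>A\<close>, \<open>t\<close> and \<open>t\<^sup>-\<^sup>1\<close>.
\<close>

definition (in hnn_decomposition) word_value :: "'a hnn_letter list \<Rightarrow> 'a" where
  "word_value w = foldr (\<lambda>l g. letter_value l \<otimes> g) w \<one>"

text \<open>
  The words of the presentation, in the letters \<open>t\<close>, \<open>t\<^sup>-\<^sup>1\<close> and the elements of \<open>A\<close>.
\<close>

abbreviation (in hnn_decomposition) words :: "'a hnn_letter list set" where
  "words \<equiv> hnn_words (G\<lparr>carrier := A\<rparr>)"

text \<open>
  Two words represent the same element of \<open>G\<close> exactly if they are equal modulo the relations, and
  every element is represented: this is the isomorphism in the definition of a decomposition,
  stated for words.
\<close>

lemma (in hnn_decomposition) word_value_presentation: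
  shows stable_closed [simp]: "t \<in> carrier G"
    and word_value_image: "word_value ` words = carrier G"
    and word_value_eq_iff: "\<lbrakk>u \<in> words; v \<in> words\<rbrakk>
      \<Longrightarrow> word_value u = word_value v \<longleftrightarrow> hnn_eq (G\<lparr>carrier := A\<rparr>) C \<phi> u v"
proof -
  let ?K = "G\<lparr>carrier := A\<rparr>"
  let ?H = "hnn_extension ?K C \<phi>"
  let ?cl = "hnn_class ?K C \<phi>"
  obtain h where h: "h \<in> iso ?H G" "\<And>a. a \<in> A \<Longrightarrow> h (?cl [Base a]) = a" "h (?cl [Stable]) = t"
    using iso_hnn_extension by blast
  interpret H: group ?H
    by (rule hnn_extension_group[OF subgroup_imp_group[OF subgroup_A]])
  interpret h: group_hom ?H G h
    by unfold_locales (use h(1) in \<open>simp add: iso_def\<close>)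
  have carr: "carrier ?H = ?cl ` words" and one: "\<one>\<^bsub>?H\<^esub> = ?cl []"
    by (simp_all add: hnn_extension_def)
  have bij: "bij_betw h (carrier ?H) (carrier G)"
    using h(1) by (simp add: iso_def)
  have mult: "h (?cl (u @ v)) = h (?cl u) \<otimes> h (?cl v)" if "u \<in> words" "v \<in> words" for u v
    unfolding hnn_class_mult[OF that, symmetric]
    using that carr by simp
  have nil: "h (?cl []) = \<one>"
    using h.hom_one one by simp
  have w: "[Stable] \<in> words" "[Stable_inv] \<in> words" "[] \<in> words"
    by (auto simp: hnn_words_def)
  have cl: "h (?cl u) \<in> carrier G" if "u \<in> words" for u
    using that carr h.hom_closed by simp
  show t: "t \<in> carrier G"
    using cl[OF w(1)] h(3) by simp
  have "?cl [Stable_inv, Stable] = ?cl []"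
    using hnn_class_eq_iff[of "[Stable_inv, Stable]" ?K C \<phi> "[]"] hnn_eq.stable_l_inv[of ?K C \<phi>]
    by (simp add: hnn_words_def)
  then have "h (?cl [Stable_inv]) \<otimes> t = \<one>"
    using mult[OF w(2,1)] h(3) nil by simp
  then have inv: "h (?cl [Stable_inv]) = inv t"
    using t cl[OF w(2)] by (metis inv_equality)
  have value_cl: "h (?cl w) = word_value w" if "w \<in> words" for w
    using that
  proof (induction w)
    case Nil
    then show ?case by (simp add: nil word_value_def)
  next
    case (Cons l w)
    then have w: "w \<in> words" "[l] \<in> words"
      by (auto simp: hnn_words_def)
    moreover have "h (?cl [l]) = letter_value l"
      using w(2) h inv by (cases l) (auto simp: hnn_words_def)
    ultimately show ?case
      using Cons.IH mult[OF w(2,1)] by (simp add: word_value_def)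
  qed
  have "word_value ` words = h ` carrier ?H"
    unfolding carr image_image using value_cl by (intro image_cong) auto
  then show "word_value ` words = carrier G"
    using bij by (simp add: bij_betw_def)
  assume uv: "u \<in> words" "v \<in> words"
  then have "h (?cl u) = h (?cl v) \<longleftrightarrow> ?cl u = ?cl v"
    using bij by (auto simp: bij_betw_def inj_on_def carr)
  then show "word_value u = word_value v \<longleftrightarrow> hnn_eq ?K C \<phi> u v"
    using value_cl uv hnn_class_eq_iff[OF uv(1), of C \<phi> v] by simp
qed

lemma (in hnn_decomposition) letter_value_closed:
  "[l] \<in> words \<Longrightarrow> letter_value l \<in> carrier G"
  using subgroups by (cases l) (auto simp: hnn_words_def)

lemma (in hnn_decomposition) word_value_closed: "w \<in> words \<Longrightarrow> word_value w \<in> carrier G"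
  using word_value_image by blast

lemma (in hnn_decomposition) word_value_append:
  "\<lbrakk>u \<in> words; v \<in> words\<rbrakk> \<Longrightarrow> word_value (u @ v) = word_value u \<otimes> word_value v"
proof (induction u)
  case Nil
  then show ?case using word_value_closed[of v] by (simp add: word_value_def)
next
  case (Cons l u)
  then have "u \<in> words" "[l] \<in> words"
    by (auto simp: hnn_words_def)
  then show ?case
    using Cons word_value_closed[of u] word_value_closed[of v] letter_value_closed[of l]
    by (simp add: word_value_def m_assoc)
qed

lemma (in hnn_decomposition) word_value_single:
  "[l] \<in> words \<Longrightarrow> word_value [l] = letter_value l"
  using letter_value_closed[of l] by (simp add: word_value_def)

lemma (in hnn_decomposition) phi_closed: "c \<in> C \<Longrightarrow> \<phi> c \<in> A"
  using subgroups iso_C_D by (auto simp: iso_def hom_def)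

lemma (in hnn_decomposition) stable_conj:
  assumes "c \<in> C"
  shows "t \<otimes> c \<otimes> inv t = \<phi> c"
proof -
  have c: "c \<in> A" "\<phi> c \<in> A" "c \<in> carrier G" "\<phi> c \<in> carrier G"
    using assms subgroups phi_closed[OF assms] by blast+
  have "word_value [Stable, Base c, Stable_inv] = word_value [Base (\<phi> c)]"
    using word_value_eq_iff[of "[Stable, Base c, Stable_inv]" "[Base (\<phi> c)]"]
      c hnn_eq.conj[OF assms, of "G\<lparr>carrier := A\<rparr>" \<phi>] by (simp add: hnn_words_def)
  then show ?thesis
    using c by (simp add: word_value_def m_assoc)
qed

lemma (in hnn_decomposition) phi_image: "\<phi> ` C = D"
  using iso_C_D by (simp add: iso_def bij_betw_def)

lemma (in hnn_decomposition) generation_induct [consumes 1, case_names one base stable stable_inv]: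
  assumes "g \<in> carrier G" "P \<one>"
    and "\<And>g a. \<lbrakk>g \<in> carrier G; P g; a \<in> A\<rbrakk> \<Longrightarrow> P (g \<otimes> a)"
    and "\<And>g. \<lbrakk>g \<in> carrier G; P g\<rbrakk> \<Longrightarrow> P (g \<otimes> t)"
    and "\<And>g. \<lbrakk>g \<in> carrier G; P g\<rbrakk> \<Longrightarrow> P (g \<otimes> inv t)"
  shows "P g"
proof -
  have "P (word_value w)" if "w \<in> words" for w
    using that
  proof (induction w rule: rev_induct)
    case Nil
    then show ?case using assms(2) by (simp add: word_value_def)
  next
    case (snoc l w)
    then have w: "w \<in> words" "[l] \<in> words"
      by (auto simp: hnn_words_def)
    from this have "word_value (w @ [l]) = word_value w \<otimes> letter_value l"
      by (simp add: word_value_append word_value_single)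
    moreover have "P (word_value w \<otimes> letter_value l)"
    proof (cases l)
      case (Base a)
      then have "a \<in> A"
        using w(2) by (auto simp: hnn_words_def)
      then show ?thesis
        using Base assms(3)[OF word_value_closed[OF w(1)] snoc.IH[OF w(1)]] by simp
    qed (use assms(4,5)[OF word_value_closed[OF w(1)] snoc.IH[OF w(1)]] in simp_all)
    ultimately show ?case by simp
  qed
  moreover obtain w where "w \<in> words" "g = word_value w"
    using assms(1) unfolding word_value_image[symmetric] by (rule imageE)
  ultimately show ?thesis by simp
qed

text \<open>
  The universal property in the form in which it is used: permutations of a set \<open>X\<close> that satisfy
  the defining relations extend to a right action of \<open>G\<close> on \<open>X\<close>.
\<close>

lemma (in hnn_decomposition) right_action:
  fixes \<alpha> :: "'a \<Rightarrow> 'x \<Rightarrow> 'x" and \<tau> \<tau>' :: "'x \<Rightarrow> 'x"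
  assumes closed: "\<And>a x. \<lbrakk>a \<in> A; x \<in> X\<rbrakk> \<Longrightarrow> \<alpha> a x \<in> X"
      "\<And>x. x \<in> X \<Longrightarrow> \<tau> x \<in> X" "\<And>x. x \<in> X \<Longrightarrow> \<tau>' x \<in> X"
    and one: "\<And>x. x \<in> X \<Longrightarrow> \<alpha> \<one> x = x"
    and mult: "\<And>a b x. \<lbrakk>a \<in> A; b \<in> A; x \<in> X\<rbrakk> \<Longrightarrow> \<alpha> (a \<otimes> b) x = \<alpha> b (\<alpha> a x)"
    and inverse: "\<And>x. x \<in> X \<Longrightarrow> \<tau>' (\<tau> x) = x" "\<And>x. x \<in> X \<Longrightarrow> \<tau> (\<tau>' x) = x"
    and conj: "\<And>c x. \<lbrakk>c \<in> C; x \<in> X\<rbrakk> \<Longrightarrow> \<tau>' (\<alpha> c (\<tau> x)) = \<alpha> (\<phi> c) x"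
  obtains act :: "'a \<Rightarrow> 'x \<Rightarrow> 'x" where
    "\<forall>g\<in>carrier G. \<forall>x\<in>X. act g x \<in> X"
    "\<forall>g\<in>carrier G. \<forall>h\<in>carrier G. \<forall>x\<in>X. act (g \<otimes> h) x = act h (act g x)"
    "\<forall>x\<in>X. act \<one> x = x"
    "\<forall>a\<in>A. \<forall>x\<in>X. act a x = \<alpha> a x"
    "\<forall>x\<in>X. act t x = \<tau> x" "\<forall>x\<in>X. act (inv t) x = \<tau>' x"
proof -
  let ?K = "G\<lparr>carrier := A\<rparr>"
  define step where "step l = (case l of Base a \<Rightarrow> \<alpha> a | Stable \<Rightarrow> \<tau> | Stable_inv \<Rightarrow> \<tau>')" for l
  define run where "run w x = fold step w x" for w x
  have run_app: "run (u @ v) x = run v (run u x)" for u v x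
    by (simp add: run_def)
  have run_closed: "run w x \<in> X" if "w \<in> words" "x \<in> X" for w x
    using that
  proof (induction w arbitrary: x)
    case (Cons l w)
    then have "step l x \<in> X"
      using closed by (auto simp: step_def hnn_words_def split: hnn_letter.split)
    with Cons show ?case by (simp add: run_def hnn_words_def)
  qed (simp add: run_def)
  have words: "u \<in> words \<and> v \<in> words" if "hnn_eq ?K C \<phi> u v" for u v
    using that
  proof (induction rule: hnn_eq.induct)
    case (conj c)
    then show ?case using subgroups(1) phi_closed by (auto simp: hnn_words_def)
  next
    case (append u u' v v')
    then show ?case by (simp add: hnn_words_def)
  qed (simp_all add: hnn_words_def subgroup.one_closed[OF subgroup_A] subgroup.m_closed[OF subgroup_A])
  have run_eq: "\<forall>x\<in>X. run u x = run v x" if "hnn_eq ?K C \<phi> u v" for u v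
    using that
  proof (induction rule: hnn_eq.induct)
    case (sym u v)
    then show ?case by simp
  next
    case (trans u v w)
    then show ?case by simp
  next
    case (append u u' v v')
    then have "u \<in> words"
      using words by blast
    then have "run v (run u x) = run v' (run u' x)" if "x \<in> X" for x
      using append.IH(1) bspec[OF append.IH(2) run_closed[of u x]] that by simp
    then show ?case
      by (simp add: run_app)
  next
    case (conj c)
    then show ?case using assms(8) by (simp add: run_def step_def)
  qed (simp_all add: run_def step_def inverse one mult)
  \<comment> \<open>By \<open>run_eq\<close> the choice of a word for \<open>g\<close> does not matter.\<close>
  define word where "word g = (SOME w. w \<in> words \<and> word_value w = g)" for g
  have word: "word g \<in> words" "word_value (word g) = g" if "g \<in> carrier G" for g
  proof -
    have "\<exists>w. w \<in> words \<and> word_value w = g"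
      using that unfolding word_value_image[symmetric] by auto
    from someI_ex[OF this] show "word g \<in> words" "word_value (word g) = g"
      unfolding word_def by simp_all
  qed
  define act where "act g x = run (word g) x" for g x
  have act: "act (word_value w) x = run w x" if "w \<in> words" "x \<in> X" for w x
  proof -
    note w = word[OF word_value_closed[OF that(1)]]
    have "hnn_eq ?K C \<phi> (word (word_value w)) w"
      using word_value_eq_iff[OF w(1) that(1)] w(2) by simp
    then show ?thesis
      using run_eq that(2) by (simp add: act_def)
  qed
  have r1: "act g x \<in> X" if "g \<in> carrier G" "x \<in> X" for g x
    using run_closed[OF word(1)[OF that(1)] that(2)] by (simp add: act_def)
  have r2: "act (g \<otimes> h) x = act h (act g x)"
    if "g \<in> carrier G" "h \<in> carrier G" "x \<in> X" for g h x
  proof -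
    have w: "word g \<in> words" "word h \<in> words"
      using word that by auto
    then have "word g @ word h \<in> words"
      by (simp add: hnn_words_def)
    from act[OF this that(3)]
    have "act (word_value (word g @ word h)) x = run (word h) (run (word g) x)"
      by (simp only: run_app)
    then show ?thesis
      using word_value_append[OF w] word(2) that by (simp add: act_def)
  qed
  have r3: "act \<one> x = x" if "x \<in> X" for x
    using act[of "[]" x] that by (simp add: hnn_words_def run_def word_value_def)
  have r4: "act a x = \<alpha> a x" if "a \<in> A" "x \<in> X" for a x
    using act[of "[Base a]" x] word_value_single[of "Base a"] that
    by (simp add: hnn_words_def run_def step_def)
  have r5: "act t x = \<tau> x" if "x \<in> X" for x
    using act[of "[Stable]" x] word_value_single[of Stable] that
    by (simp add: hnn_words_def run_def step_def)
  have r6: "act (inv t) x = \<tau>' x" if "x \<in> X" for x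
    using act[of "[Stable_inv]" x] word_value_single[of Stable_inv] that
    by (simp add: hnn_words_def run_def step_def)
  show thesis
    by (intro that[of act] ballI r1 r2 r3 r4 r5 r6)
qed

section \<open>Finite quotients\<close>

text \<open>
  An HNN decomposition of \<open>G\<close> together with a normal subgroup \<open>N\<close> of \<open>G\<close>.
\<close>

locale hnn_normal_subgroup = hnn_decomposition G A C D \<phi> t + N: normal N G
  for G (structure) and A C D \<phi> t N
begin

lemma NC_subgroup: "subgroup (N <#> C) G"
  by (intro second_isomorphism_grp.normal_set_mult_subgroup second_isomorphism_grp.intro
      second_isomorphism_grp_axioms.intro N.normal_axioms subgroups(4))

lemma finite_quotient_iff:
  assumes "finite_index G (N <#> C)"
  shows "finite (carrier (G Mod N)) \<longleftrightarrow> finite (carrier ((G\<lparr>carrier := C\<rparr>) Mod (N \<inter> C)))"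
proof -
  interpret C: subgroup C G by (rule subgroups)
  have inter: "subgroup (N \<inter> C) G"
    using subgroups_Inter_pair N.subgroup_axioms subgroups(4) by blast
  have eq: "(N \<inter> C) #> c = (N \<inter> C) #> d \<longleftrightarrow> N #> c = N #> d" if "c \<in> C" "d \<in> C" for c d
    using that r_coset_eq_iff[OF inter, of c d] r_coset_eq_iff[OF N.subgroup_axioms, of c d] by auto
  have carr: "carrier ((G\<lparr>carrier := C\<rparr>) Mod (N \<inter> C)) = (\<lambda>c. (N \<inter> C) #> c) ` C"
    by (auto simp: FactGroup_def RCOSETS_def)
  have carrG: "carrier (G Mod N) = (\<lambda>c. N #> c) ` carrier G"
    by (auto simp: FactGroup_def RCOSETS_def)
  have "finite ((\<lambda>c. (N \<inter> C) #> c) ` C) \<longleftrightarrow> finite ((\<lambda>c. N #> c) ` C)"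
    by (intro iffI; erule finite_image_if_coarser[rotated]) (simp_all add: eq)
  moreover have "finite (carrier (G Mod N))" if fin: "finite ((\<lambda>c. N #> c) ` C)"
  proof -
    obtain Q where Q: "finite Q" "Q \<subseteq> carrier G"
      "\<forall>g\<in>carrier G. \<exists>n\<in>N. \<exists>q\<in>Q. \<exists>c\<in>C. g = n \<otimes> q \<otimes> c"
      by (rule finite_index_set_multE[OF assms N.normal_axioms subgroups(4)])
    have "(\<lambda>g. N #> g) ` carrier G \<subseteq> (\<lambda>(X, Y). X <#> Y) ` ((\<lambda>q. N #> q) ` Q \<times> (\<lambda>c. N #> c) ` C)"
    proof
      fix X assume "X \<in> (\<lambda>g. N #> g) ` carrier G"
      then obtain g where g: "g \<in> carrier G" "X = N #> g" by blast
      obtain n q c where nqc: "n \<in> N" "q \<in> Q" "c \<in> C" "g = n \<otimes> q \<otimes> c"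
        using bspec[OF Q(3) g(1)] by blast
      then have "q \<in> carrier G" using Q(2) by blast
      then have "N #> g = (N #> q) <#> (N #> c)"
        using nqc N.rcos_sum[of q c] r_coset_eq_iff[OF N.subgroup_axioms, of g "q \<otimes> c"]
        by (simp add: inv_mult_group m_assoc)
      then show "X \<in> (\<lambda>(X, Y). X <#> Y) ` ((\<lambda>q. N #> q) ` Q \<times> (\<lambda>c. N #> c) ` C)"
        using g(2) nqc(2,3) by (intro image_eqI[of _ _ "(N #> q, N #> c)"]) simp_all
    qed
    from finite_subset[OF this] show ?thesis
      unfolding carrG using fin Q(1) by simp
  qed
  moreover have "finite ((\<lambda>c. N #> c) ` C)" if "finite (carrier (G Mod N))"
    using that finite_subset[OF image_mono[OF C.subset]] unfolding carrG by simp
  ultimately show ?thesis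
    unfolding carr by argo
qed

section \<open>The index of \<open>NC\<close>\<close>

text \<open>
  The cosets of \<open>C\<close> by the powers of \<open>t\<close> are distinct, since the height function \<open>G \<rightarrow> \<int>\<close> with
  \<open>A \<mapsto> 0\<close> and \<open>t \<mapsto> 1\<close> separates them.
\<close>

lemma not_subset_if_finite_index:
  assumes "finite_index G (N <#> C)"
  shows "\<not> N \<subseteq> C"
proof
  assume "N \<subseteq> C"
  interpret C: subgroup C G by (rule subgroups)
  have "N <#> C \<subseteq> C"
    using \<open>N \<subseteq> C\<close> C.m_closed by (auto simp: set_mult_def)
  then have fin: "finite (rcosets (N <#> C))" and NC: "N <#> C \<subseteq> C"
    using assms by (auto simp: finite_index_def)
  let ?Z = "UNIV :: int set"
  obtain act where act':
    "\<forall>g\<in>carrier G. \<forall>x\<in>?Z. act g x \<in> ?Z"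
    "\<forall>g\<in>carrier G. \<forall>h\<in>carrier G. \<forall>x\<in>?Z. act (g \<otimes> h) x = act h (act g x)"
    "\<forall>x\<in>?Z. act \<one> x = x" "\<forall>a\<in>A. \<forall>x\<in>?Z. act a x = x"
    "\<forall>x\<in>?Z. act t x = x + 1" "\<forall>x\<in>?Z. act (inv t) x = x - 1"
    by (rule right_action[of ?Z "\<lambda>_ x. x" "\<lambda>x. x + 1" "\<lambda>x. x - 1"]) (rule UNIV_I | simp)+
  have act: "\<lbrakk>g \<in> carrier G; h \<in> carrier G\<rbrakk> \<Longrightarrow> act (g \<otimes> h) x = act h (act g x)"
    "act \<one> x = x" "act t x = x + 1" for g h x
    using act' by simp_all
  have pow: "act (t [^] n) x = x + int n" for n :: nat and x
    by (induction n) (simp_all add: act)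
  have "inj (\<lambda>n::nat. (N <#> C) #> (t [^] n))"
  proof (rule injI)
    fix m n :: nat
    assume "(N <#> C) #> (t [^] m) = (N <#> C) #> (t [^] n)"
    then have "t [^] m \<otimes> inv (t [^] n) \<in> A"
      using r_coset_eq_iff[OF NC_subgroup] NC subgroups(1) by auto
    then have "act (t [^] m \<otimes> inv (t [^] n)) 0 = 0"
      using act'(4) by simp
    then have "act (inv (t [^] n)) (int m) = 0"
      by (simp add: act pow)
    then have "act (t [^] n) (act (inv (t [^] n)) (int m)) = int n"
      by (simp add: pow)
    then show "m = n"
      by (simp flip: act(1) add: act(2))
  qed
  then have "infinite (range (\<lambda>n::nat. (N <#> C) #> (t [^] n)))"
    by (simp add: finite_image_iff)
  moreover have "range (\<lambda>n::nat. (N <#> C) #> (t [^] n)) \<subseteq> rcosets (N <#> C)"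
  proof
    fix X assume "X \<in> range (\<lambda>n::nat. (N <#> C) #> (t [^] n))"
    then obtain n :: nat where "X = (N <#> C) #> (t [^] n)" by (rule rangeE)
    then show "X \<in> rcosets (N <#> C)"
      using rcosetsI[OF subgroup.subset[OF NC_subgroup], of "t [^] n"] by simp
  qed
  ultimately show False
    using fin finite_subset by blast
qed

text \<open>
  The side of the edge \<open>C\<close> of the Bass--Serre tree on which the vertex \<open>gA\<close> lies. Crossing the edge
  \<open>gC\<close>, from \<open>gA\<close> to \<open>gt\<^sup>-\<^sup>1A\<close>, changes the side precisely if \<open>gC = C\<close>.
\<close>

lemma side_function:
  obtains \<chi> :: "'a \<Rightarrow> bool" where
    "\<forall>g\<in>carrier G. \<forall>a\<in>A. \<chi> (g \<otimes> a) = \<chi> g"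
    "\<forall>g\<in>carrier G. \<chi> (g \<otimes> inv t) = (\<chi> g \<noteq> (g \<in> C))"
    "\<forall>g\<in>carrier G. \<chi> (g \<otimes> t) = (\<chi> g \<noteq> (g \<otimes> t \<in> C))"
    "\<forall>c\<in>C. \<forall>g\<in>carrier G. \<chi> (c \<otimes> g) = \<chi> g"
proof -
  interpret C: subgroup C G by (rule subgroups)
  have A: "a \<in> carrier G" if "a \<in> A" for a
    using subgroups(3) that by blast
  let ?X = "carrier G \<times> (UNIV :: bool set)"
  let ?\<alpha> = "\<lambda>a (g, b). (g \<otimes> a, b)"
  let ?\<tau> = "\<lambda>(g, b). (g \<otimes> t, b \<noteq> (g \<otimes> t \<in> C))"
  let ?\<tau>' = "\<lambda>(g, b). (g \<otimes> inv t, b \<noteq> (g \<in> C))"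
  have conj: "?\<tau>' (?\<alpha> c (?\<tau> x)) = ?\<alpha> (\<phi> c) x" if c: "c \<in> C" and x': "x \<in> ?X" for c x
  proof -
    obtain g b where x: "x = (g, b)" "g \<in> carrier G"
      using x' by auto
    have "g \<otimes> t \<otimes> c \<otimes> inv c \<in> C" if "g \<otimes> t \<otimes> c \<in> C"
      using that c by blast
    then have "g \<otimes> t \<in> C" if "g \<otimes> t \<otimes> c \<in> C"
      using that c x by (simp add: m_assoc)
    then have "g \<otimes> t \<otimes> c \<in> C \<longleftrightarrow> g \<otimes> t \<in> C"
      using c by blast
    then show ?thesis
      using x stable_conj[OF c, symmetric] c by (auto simp: m_assoc)
  qed
  have inverse: "?\<tau>' (?\<tau> x) = x" "?\<tau> (?\<tau>' x) = x" if "x \<in> ?X" for x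
    using that by (auto simp: m_assoc split: prod.splits)
  have closed: "?\<tau> x \<in> ?X" "?\<tau>' x \<in> ?X" "?\<alpha> \<one> x = x" if "x \<in> ?X" for x
    using that by (auto split: prod.splits)
  have mult: "?\<alpha> a x \<in> ?X" "?\<alpha> (a \<otimes> b) x = ?\<alpha> b (?\<alpha> a x)" if "a \<in> A" "b \<in> A" "x \<in> ?X" for a b x
    using that by (auto simp: A m_assoc split: prod.splits)
  obtain act where act':
    "\<forall>g\<in>carrier G. \<forall>x\<in>?X. act g x \<in> ?X"
    "\<forall>g\<in>carrier G. \<forall>h\<in>carrier G. \<forall>x\<in>?X. act (g \<otimes> h) x = act h (act g x)"
    "\<forall>x\<in>?X. act \<one> x = x"
    "\<forall>a\<in>A. \<forall>x\<in>?X. act a x = ?\<alpha> a x"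
    "\<forall>x\<in>?X. act t x = ?\<tau> x" "\<forall>x\<in>?X. act (inv t) x = ?\<tau>' x"
    by (rule right_action[of ?X ?\<alpha> ?\<tau> ?\<tau>', OF mult(1) closed(1,2,3) mult(2) inverse conj])
  note act = act'[rule_format]
  define \<chi> where "\<chi> g = snd (act g (\<one>, False))" for g
  have base: "(\<one>, False) \<in> ?X" by simp
  have fst: "fst (act g (\<one>, False)) = g" if "g \<in> carrier G" for g
    using that
  proof (induction rule: generation_induct)
    case one
    then show ?case using act(3)[OF base] by simp
  next
    case (base g a)
    then show ?case
      using act(2)[of g a "(\<one>, False)"] act(4)[of a "act g (\<one>, False)"] act(1)[of g "(\<one>, False)"] A
      by (simp split: prod.splits)
  next
    case (stable g)
    then show ?case
      using act(2)[of g t "(\<one>, False)"] act(5)[of "act g (\<one>, False)"] act(1)[of g "(\<one>, False)"]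
      by (simp split: prod.splits)
  next
    case (stable_inv g)
    then show ?case
      using act(2)[of g "inv t" "(\<one>, False)"] act(6)[of "act g (\<one>, False)"] act(1)[of g "(\<one>, False)"]
      by (simp split: prod.splits)
  qed
  have pair: "act g (\<one>, False) = (g, \<chi> g)" if "g \<in> carrier G" for g
    using fst[OF that] by (simp add: \<chi>_def prod_eq_iff)
  have *: "\<chi> (g \<otimes> a) = \<chi> g" if "g \<in> carrier G" "a \<in> A" for g a
    using that act(2)[OF that(1) A[OF that(2)] base] act(4)[of a "act g (\<one>, False)"] A
    by (simp add: pair)
  have **: "\<chi> (g \<otimes> t) = (\<chi> g \<noteq> (g \<otimes> t \<in> C))" if "g \<in> carrier G" for g
    using that act(2)[OF that stable_closed base] act(5)[of "act g (\<one>, False)"]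
    by (simp add: pair)
  have ***: "\<chi> (g \<otimes> inv t) = (\<chi> g \<noteq> (g \<in> C))" if "g \<in> carrier G" for g
    using that act(2)[of g "inv t", OF that _ base] act(6)[of "act g (\<one>, False)"]
    by (simp add: pair)
  have left: "\<chi> (c \<otimes> g) = \<chi> g" if c: "c \<in> C" and g: "g \<in> carrier G" for c g
  proof -
    have cancel: "c \<otimes> h \<in> C \<longleftrightarrow> h \<in> C" if "h \<in> carrier G" for h
    proof
      assume "c \<otimes> h \<in> C"
      then have "inv c \<otimes> (c \<otimes> h) \<in> C" using c by blast
      then show "h \<in> C" using c that by simp
    qed (use c in simp)
    show ?thesis
      using g
    proof (induction rule: generation_induct)
      case one
      have "\<chi> (\<one> \<otimes> c) = \<chi> \<one>"
        using *[of \<one> c] c subgroups(1) by blast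
      then show ?case using c by simp
    next
      case (base g a)
      then show ?case using *[of g a] *[of "c \<otimes> g" a] c A by (simp add: m_assoc)
    next
      case (stable g)
      then show ?case
        using **[of g] **[of "c \<otimes> g"] cancel[of "g \<otimes> t"] c by (simp add: m_assoc)
    next
      case (stable_inv g)
      then show ?case
        using ***[of g] ***[of "c \<otimes> g"] cancel[of g] c by (simp add: m_assoc)
    qed
  qed
  show thesis
    by (intro that[of \<chi>] ballI * ** *** left)
qed

text \<open>
  The value \<open>\<chi> (k \<otimes> n)\<close> tells on which side of the edge \<open>k\<^sup>-\<^sup>1C\<close> the vertex \<open>nA\<close> lies. So the set \<open>K\<close> of
  the proof describes the edges that separate vertices of the \<open>N\<close>-orbit of \<open>A\<close>.
\<close>

lemma finite_index_if_finitely_generated: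
  assumes fg: "finitely_generated (G\<lparr>carrier := N\<rparr>)" and not_sub: "\<not> N \<subseteq> C"
  shows "finite_index G (N <#> C)"
proof -
  interpret C: subgroup C G by (rule subgroups)
  let ?H = "N <#> C"
  interpret H: subgroup ?H G by (rule NC_subgroup)
  have A: "a \<in> carrier G" if "a \<in> A" for a
    using subgroups(3) that by blast
  obtain \<chi> :: "'a \<Rightarrow> bool" where \<chi>':
    "\<forall>g\<in>carrier G. \<forall>a\<in>A. \<chi> (g \<otimes> a) = \<chi> g"
    "\<forall>g\<in>carrier G. \<chi> (g \<otimes> inv t) = (\<chi> g \<noteq> (g \<in> C))"
    "\<forall>g\<in>carrier G. \<chi> (g \<otimes> t) = (\<chi> g \<noteq> (g \<otimes> t \<in> C))"
    "\<forall>c\<in>C. \<forall>g\<in>carrier G. \<chi> (c \<otimes> g) = \<chi> g"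
    by (rule side_function)
  note \<chi> = \<chi>'[rule_format]
  define K where "K = {k \<in> carrier G. \<exists>n\<in>N. \<exists>m\<in>N. \<chi> (k \<otimes> n) \<noteq> \<chi> (k \<otimes> m)}"
  have conj1: "x \<otimes> n \<otimes> inv x \<in> N" and conj2: "inv x \<otimes> n \<otimes> x \<in> N"
    if "x \<in> carrier G" "n \<in> N" for x n
    using that N.inv_op_closed1 N.inv_op_closed2 by auto
  have K_left: "h \<otimes> k \<in> K" if hH: "h \<in> ?H" and kK: "k \<in> K" for h k
  proof -
    obtain m c where mc: "m \<in> N" "c \<in> C" "h = m \<otimes> c"
      using hH by (rule mem_set_multE)
    obtain n n' where k: "k \<in> carrier G" "n \<in> N" "n' \<in> N" "\<chi> (k \<otimes> n) \<noteq> \<chi> (k \<otimes> n')"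
      using kK by (auto simp: K_def)
    define l where "l = inv (c \<otimes> k) \<otimes> inv m \<otimes> (c \<otimes> k)"
    have l: "l \<in> N"
      unfolding l_def using mc k by (intro conj2) auto
    have "\<chi> (h \<otimes> k \<otimes> (l \<otimes> x)) = \<chi> (k \<otimes> x)" if "x \<in> N" for x
    proof -
      have "h \<otimes> k \<otimes> (l \<otimes> x) = c \<otimes> (k \<otimes> x)"
        using mc k that by (simp add: l_def m_assoc inv_mult_group)
      then show ?thesis
        using \<chi>(4) mc k that by simp
    qed
    then have "\<chi> (h \<otimes> k \<otimes> (l \<otimes> n)) \<noteq> \<chi> (h \<otimes> k \<otimes> (l \<otimes> n'))"
      using k by simp
    moreover have "h \<otimes> k \<in> carrier G"
      using hH k by simp
    ultimately show ?thesis
      unfolding K_def using l k N.m_closed by blast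
  qed
  have K_right: "k \<otimes> x \<in> K \<longleftrightarrow> k \<in> K"
    if "k \<in> carrier G" "x \<in> carrier G" "\<And>n. n \<in> N \<Longrightarrow> \<chi> (k \<otimes> n \<otimes> x) = \<chi> (k \<otimes> n)" for k x
  proof -
    have 1: "\<chi> (k \<otimes> x \<otimes> n) = \<chi> (k \<otimes> (x \<otimes> n \<otimes> inv x))" if "n \<in> N" for n
    proof -
      have "k \<otimes> x \<otimes> n = k \<otimes> (x \<otimes> n \<otimes> inv x) \<otimes> x"
        using that \<open>k \<in> carrier G\<close> \<open>x \<in> carrier G\<close> by (simp add: m_assoc)
      then show ?thesis
        using \<open>\<And>n. n \<in> N \<Longrightarrow> \<chi> (k \<otimes> n \<otimes> x) = \<chi> (k \<otimes> n)\<close> conj1 that \<open>x \<in> carrier G\<close> by simp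
    qed
    have 2: "\<chi> (k \<otimes> n) = \<chi> (k \<otimes> x \<otimes> (inv x \<otimes> n \<otimes> x))" if "n \<in> N" for n
    proof -
      have "k \<otimes> n \<otimes> x = k \<otimes> x \<otimes> (inv x \<otimes> n \<otimes> x)"
        using that \<open>k \<in> carrier G\<close> \<open>x \<in> carrier G\<close> by (simp add: m_assoc)
      then show ?thesis
        using \<open>\<And>n. n \<in> N \<Longrightarrow> \<chi> (k \<otimes> n \<otimes> x) = \<chi> (k \<otimes> n)\<close> that by metis
    qed
    show ?thesis
    proof
      assume "k \<otimes> x \<in> K"
      then obtain n m where "n \<in> N" "m \<in> N" "\<chi> (k \<otimes> x \<otimes> n) \<noteq> \<chi> (k \<otimes> x \<otimes> m)"
        by (auto simp: K_def)
      then show "k \<in> K"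
        unfolding K_def using 1 conj1[OF that(2)] that(1) by blast
    next
      assume "k \<in> K"
      then obtain n m where "n \<in> N" "m \<in> N" "\<chi> (k \<otimes> n) \<noteq> \<chi> (k \<otimes> m)"
        by (auto simp: K_def)
      then show "k \<otimes> x \<in> K"
        unfolding K_def using 2 conj2[OF that(2)] that(1,2) m_closed by blast
    qed
  qed
  \<comment> \<open>The hypothesis of \<open>K_right\<close> says that the edge \<open>k\<^sup>-\<^sup>1C\<close> separates \<open>nA\<close> from \<open>nxA\<close> for no \<open>n\<close> in \<open>N\<close>.\<close>
  have K_A: "k \<otimes> a \<in> K \<longleftrightarrow> k \<in> K" if "k \<in> carrier G" "a \<in> A" for k a
    using that by (intro K_right \<chi>(1)) (auto simp: A)
  have K_t: "k \<otimes> inv t \<in> K \<longleftrightarrow> k \<in> K" if "k \<in> carrier G" "k \<notin> ?H" for k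
  proof (rule K_right)
    fix n assume n: "n \<in> N"
    have "k \<otimes> n \<notin> C"
    proof
      assume "k \<otimes> n \<in> C"
      then have "(k \<otimes> inv n \<otimes> inv k) \<otimes> (k \<otimes> n) \<in> ?H"
        using conj1 that n by (intro mem_set_multI) auto
      then show False
        using that n by (simp add: m_assoc)
    qed
    then show "\<chi> (k \<otimes> n \<otimes> inv t) = \<chi> (k \<otimes> n)"
      using \<chi>(2)[of "k \<otimes> n"] that n by simp
  qed (use that in auto)
  \<comment> \<open>Only finitely many edges separate the vertices \<open>A\<close> and \<open>sA\<close>: those on the path spelled out by a word for \<open>s\<close>.\<close>
  have crossing: "\<exists>F. finite F \<and> F \<subseteq> carrier G \<and>
      (\<forall>k\<in>carrier G. (\<forall>f\<in>F. k \<notin> C #> f) \<longrightarrow> \<chi> (k \<otimes> s) = \<chi> k)" if "s \<in> carrier G" for s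
    using that
  proof (induction rule: generation_induct)
    case one
    then show ?case by (intro exI[of _ "{}"]) simp
  next
    case (base g a)
    then obtain F where F: "finite F" "F \<subseteq> carrier G"
      "\<forall>k\<in>carrier G. (\<forall>f\<in>F. k \<notin> C #> f) \<longrightarrow> \<chi> (k \<otimes> g) = \<chi> k" by blast
    have "\<chi> (k \<otimes> (g \<otimes> a)) = \<chi> (k \<otimes> g)" if "k \<in> carrier G" for k
      using \<chi>(1)[of "k \<otimes> g" a] base that A by (simp add: m_assoc)
    with F show ?case by (intro exI[of _ F]) simp
  next
    case (stable g)
    then obtain F where F: "finite F" "F \<subseteq> carrier G"
      "\<forall>k\<in>carrier G. (\<forall>f\<in>F. k \<notin> C #> f) \<longrightarrow> \<chi> (k \<otimes> g) = \<chi> k" by blast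
    have "\<chi> (k \<otimes> (g \<otimes> t)) = \<chi> (k \<otimes> g)" if "k \<in> carrier G" "k \<notin> C #> inv (g \<otimes> t)" for k
    proof -
      have "k \<otimes> (g \<otimes> t) \<notin> C"
      proof
        assume "k \<otimes> (g \<otimes> t) \<in> C"
        then have "k \<otimes> (g \<otimes> t) \<otimes> inv (g \<otimes> t) \<in> C #> inv (g \<otimes> t)"
          by (auto simp: r_coset_def)
        then show False
          using that stable(1) by (simp add: m_assoc inv_mult_group)
      qed
      then show ?thesis
        using \<chi>(3)[of "k \<otimes> g"] stable(1) that by (simp add: m_assoc)
    qed
    with F stable(1) show ?case by (intro exI[of _ "insert (inv (g \<otimes> t)) F"]) simp
  next
    case (stable_inv g)
    then obtain F where F: "finite F" "F \<subseteq> carrier G"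
      "\<forall>k\<in>carrier G. (\<forall>f\<in>F. k \<notin> C #> f) \<longrightarrow> \<chi> (k \<otimes> g) = \<chi> k" by blast
    have "\<chi> (k \<otimes> (g \<otimes> inv t)) = \<chi> (k \<otimes> g)" if "k \<in> carrier G" "k \<notin> C #> inv g" for k
    proof -
      have "k \<otimes> g \<notin> C"
      proof
        assume "k \<otimes> g \<in> C"
        then have "k \<otimes> g \<otimes> inv g \<in> C #> inv g"
          by (auto simp: r_coset_def)
        then show False
          using that stable_inv(1) by (simp add: m_assoc)
      qed
      then show ?thesis
        using \<chi>(2)[of "k \<otimes> g"] stable_inv(1) that by (simp add: m_assoc)
    qed
    with F stable_inv(1) show ?case by (intro exI[of _ "insert (inv g) F"]) simp
  qed
  obtain S where S: "finite S" "S \<subseteq> N" "generate G S = N"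
    using fg finitely_generated_subgroup_iff[OF N.subgroup_axioms] by blast
  have Sc: "s \<in> carrier G" if "s \<in> S" for s
    using subsetD[OF S(2) that] by simp
  obtain Fs where Fs': "\<forall>s\<in>carrier G. finite (Fs s) \<and> Fs s \<subseteq> carrier G \<and>
      (\<forall>k\<in>carrier G. (\<forall>f\<in>Fs s. k \<notin> C #> f) \<longrightarrow> \<chi> (k \<otimes> s) = \<chi> k)"
    using bchoice[OF ballI[OF crossing]] by (rule exE)
  note Fs = bspec[OF Fs']
  define F where "F = (\<Union>s\<in>S. Fs s \<union> Fs (inv s))"
  have F: "finite F" "F \<subseteq> carrier G"
  proof -
    show "finite F"
      unfolding F_def using S(1) Fs Sc by simp
    show "F \<subseteq> carrier G"
      unfolding F_def using Fs Sc by (intro UN_least Un_least) simp_all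
  qed
  have coset: "k \<in> C #> f \<Longrightarrow> ?H #> k = ?H #> f" if "k \<in> carrier G" "f \<in> carrier G" for k f
  proof -
    assume "k \<in> C #> f"
    then obtain c where c: "c \<in> C" "k = c \<otimes> f" by (auto simp: r_coset_def)
    then have "k \<otimes> inv f = \<one> \<otimes> c" using that by (simp add: m_assoc)
    then show ?thesis
      using r_coset_eq_iff[OF NC_subgroup] that c mem_set_multI[OF N.one_closed c(1)] by simp
  qed
  \<comment> \<open>Outside the finitely many cosets \<open>NCf\<close>, no generator changes the side, whichever vertex of the orbit it starts from.\<close>
  have const: "\<chi> (k \<otimes> n) = \<chi> k"
    if "n \<in> generate G S" "k \<in> carrier G" "\<And>f. f \<in> F \<Longrightarrow> ?H #> k \<noteq> ?H #> f" for n k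
    using that
  proof (induction arbitrary: k rule: generate.induct)
    case one
    then show ?case by simp
  next
    case (incl s)
    have "k \<notin> C #> f" if "f \<in> Fs s" for f
    proof -
      have "f \<in> F"
        using that incl(1) by (auto simp: F_def)
      then show ?thesis
        using coset[OF incl(2)] incl(3) F(2) by blast
    qed
    then show ?case
      using conjunct2[OF conjunct2[OF Fs[OF Sc[OF incl(1)]]]] incl(2) by simp
  next
    case (inv s)
    have "k \<notin> C #> f" if "f \<in> Fs (inv s)" for f
    proof -
      have "f \<in> F"
        using that inv(1) by (auto simp: F_def)
      then show ?thesis
        using coset[OF inv(2)] inv(3) F(2) by blast
    qed
    then show ?case
      using conjunct2[OF conjunct2[OF Fs[OF inv_closed[OF Sc[OF inv(1)]]]]] inv(2) by simp
  next
    case (eng m n)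
    then have mn: "m \<in> N" "n \<in> N" using S(3) by auto
    have "k \<otimes> m \<otimes> inv k \<otimes> \<one> \<in> ?H"
      using conj1[OF eng(5) mn(1)] by (rule mem_set_multI) simp
    then have "?H #> k \<otimes> m = ?H #> k"
      using r_coset_eq_iff[OF NC_subgroup, of "k \<otimes> m" k] mn eng(5) by simp
    then have "\<chi> (k \<otimes> m \<otimes> n) = \<chi> (k \<otimes> m)"
      using eng(5,6) mn by (intro eng.IH(2)) auto
    then show ?case
      using eng.IH(1)[OF eng(5,6)] mn eng(5) by (simp add: m_assoc)
  qed
  have K_F: "\<exists>f\<in>F. ?H #> k = ?H #> f" if "k \<in> K" for k
  proof (rule ccontr)
    assume "\<not> ?thesis"
    moreover have "k \<in> carrier G"
      using that by (simp add: K_def)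
    ultimately have "\<chi> (k \<otimes> n) = \<chi> k" if "n \<in> N" for n
      using that S(3) by (intro const) auto
    then show False
      using that by (simp add: K_def)
  qed
  have "(\<lambda>k. ?H #> k) ` K \<subseteq> (\<lambda>f. ?H #> f) ` F"
    using K_F by (simp add: image_subset_iff image_iff)
  then have fin: "finite ((\<lambda>k. ?H #> k) ` K)"
    by (rule finite_subset) (simp add: F(1))
  have K_sub: "K \<subseteq> carrier G"
    by (simp add: K_def)
  have K_t: "k \<in> K \<longleftrightarrow> k \<otimes> inv t \<in> K" if "k \<in> carrier G" for k
    by (rule translate_eq_if_agree_off_subgroup
        [OF NC_subgroup K_sub K_left fin stable_closed K_t[symmetric] that])
  show ?thesis
  proof (cases "K = {}")
    case False
    then obtain k where k: "k \<in> K" "k \<in> carrier G" by (auto simp: K_def)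
    have kg: "k \<otimes> g \<in> K" if "g \<in> carrier G" for g
      using that
    proof (induction rule: generation_induct)
      case one
      then show ?case using k by simp
    next
      case (base g a)
      then show ?case using K_A[of "k \<otimes> g" a] k A by (simp add: m_assoc)
    next
      case (stable g)
      then show ?case using K_t[of "k \<otimes> g \<otimes> t"] k by (simp add: m_assoc)
    next
      case (stable_inv g)
      then show ?case using K_t[of "k \<otimes> g"] k by (simp add: m_assoc)
    qed
    have all_K: "g \<in> K" if "g \<in> carrier G" for g
      using kg[of "inv k \<otimes> g"] that k(2) by simp
    have "finite (rcosets ?H)"
      by (intro finite_rcosetsI[OF F(1)] K_F all_K)
    then show ?thesis
      using NC_subgroup by (simp add: finite_index_def)
  next
    case True
    have const: "\<chi> (k \<otimes> n) = \<chi> k" if "k \<in> carrier G" "n \<in> N" for k n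
    proof (rule ccontr)
      assume "\<not> ?thesis"
      then have "\<chi> (k \<otimes> n) \<noteq> \<chi> (k \<otimes> \<one>)"
        using that by simp
      then have "k \<in> K"
        unfolding K_def using that N.one_closed by blast
      then show False
        using True by simp
    qed
    \<comment> \<open>No edge separates vertices of one \<open>N\<close>-orbit. So \<open>C\<close>, which separates \<open>A\<close> from \<open>t\<^sup>-\<^sup>1A\<close>,
        also separates \<open>nA\<close> from \<open>nt\<^sup>-\<^sup>1A\<close>; but only \<open>nC\<close> does.\<close>
    have "n \<in> C" if n: "n \<in> N" for n
    proof -
      have "inv t \<otimes> (t \<otimes> n \<otimes> inv t) = n \<otimes> inv t"
        using n by (simp add: m_assoc)
      then have "\<chi> (n \<otimes> inv t) = \<chi> (inv t)"
        using const[of "inv t" "t \<otimes> n \<otimes> inv t"] conj1[of t n] n by simp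
      then have "\<chi> (n \<otimes> inv t) \<noteq> \<chi> n"
        using const[of \<one> n] \<chi>(2)[of \<one>] n by simp
      then show ?thesis
        using \<chi>(2)[of n] n by auto
    qed
    then show ?thesis using not_sub by blast
  qed
qed

section \<open>Generators of \<open>N\<close>\<close>

text \<open>
  The argument is the one that finds generators of a group acting on a connected graph with finite
  quotient: \<open>R\<close> represents the \<open>N\<close>-orbits of vertices \<open>gA\<close>, and contains both ends \<open>qA\<close> and
  \<open>qt\<^sup>-\<^sup>1A\<close> of each of the representatives \<open>qC\<close> of the orbits of edges.
\<close>

lemma finitely_generated_if_finite_index:
  assumes fi: "finite_index G (N <#> C)"
    and fg: "finitely_generated (G\<lparr>carrier := N \<inter> A\<rparr>)"
  shows "finitely_generated (G\<lparr>carrier := N\<rparr>)"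
proof -
  interpret A: subgroup A G by (rule subgroup_A)
  interpret C: subgroup C G by (rule subgroups)
  have NA: "subgroup (N \<inter> A) G"
    using subgroups_Inter_pair N.subgroup_axioms subgroup_A by blast
  obtain S where S: "finite S" "S \<subseteq> N \<inter> A" "generate G S = N \<inter> A"
    using fg finitely_generated_subgroup_iff[OF NA] by blast
  obtain Q where Q: "finite Q" "Q \<subseteq> carrier G"
    "\<forall>g\<in>carrier G. \<exists>n\<in>N. \<exists>q\<in>Q. \<exists>c\<in>C. g = n \<otimes> q \<otimes> c"
    by (rule finite_index_set_multE[OF fi N.normal_axioms subgroups(4)])
  define R where "R = insert \<one> (Q \<union> (\<lambda>q. q \<otimes> inv t) ` Q)"
  have R: "finite R" "R \<subseteq> carrier G" "\<one> \<in> R"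
    using Q(1,2) by (auto simp: R_def)
  \<comment> \<open>The elements of \<open>N\<close> that move the vertex \<open>sA\<close> to \<open>rA\<close>.\<close>
  define link where "link r s y \<longleftrightarrow> y \<in> N \<and> (\<exists>a\<in>A. y = r \<otimes> a \<otimes> inv s)" for r s y
  define \<nu> where "\<nu> r s = (SOME y. link r s y)" for r s
  \<comment> \<open>Generators of the stabilizers \<open>N \<inter> rAr\<^sup>-\<^sup>1\<close>, and one element of each nonempty set of links.\<close>
  define Z where "Z = (\<lambda>(r, z). r \<otimes> z \<otimes> inv r) ` (R \<times> S) \<union>
    (\<lambda>(r, s). \<nu> r s) ` {p \<in> R \<times> R. \<exists>y. link (fst p) (snd p) y}"
  have \<nu>: "link r s (\<nu> r s)" if "link r s y" for r s y
    unfolding \<nu>_def using that by (rule someI)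
  have Z: "finite Z" "Z \<subseteq> N"
  proof -
    show "finite Z"
      unfolding Z_def using R(1) S(1) by simp
    have "r \<otimes> z \<otimes> inv r \<in> N" if "r \<in> R" "z \<in> S" for r z
      using that S(2) R(2) by (intro N.inv_op_closed2) auto
    moreover have "\<nu> r s \<in> N" if "link r s y" for r s y
      using \<nu>[OF that] by (simp add: link_def)
    ultimately show "Z \<subseteq> N"
      unfolding Z_def by auto
  qed
  then have Zc: "Z \<subseteq> carrier G"
    using N.subset by (rule_tac subset_trans)
  let ?M = "generate G Z"
  interpret M: subgroup ?M G
    by (rule generate_is_subgroup[OF Zc])
  have MN: "?M \<subseteq> N"
    by (rule generate_subgroup_incl[OF Z(2) N.subgroup_axioms])
  have link_M: "y \<in> ?M" if rR: "r \<in> R" and sR: "s \<in> R" and l: "link r s y" for r s y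
  proof -
    have rs: "r \<in> carrier G" "s \<in> carrier G"
      using rR sR R(2) by auto
    obtain a where a: "a \<in> A" "y = r \<otimes> a \<otimes> inv s" "y \<in> N"
      using l by (auto simp: link_def)
    obtain b where b: "b \<in> A" "\<nu> r s = r \<otimes> b \<otimes> inv s" "\<nu> r s \<in> N"
      using \<nu>[OF l] by (auto simp: link_def)
    have "\<nu> r s \<in> Z"
      unfolding Z_def using rR sR l by (intro UnI2 image_eqI[of _ _ "(r, s)"]) auto
    then have \<nu>M: "\<nu> r s \<in> ?M"
      by (rule generate.incl)
    have eq: "y \<otimes> inv (\<nu> r s) = r \<otimes> (a \<otimes> inv b) \<otimes> inv r"
      using a b rs by (simp add: inv_mult_group m_assoc)
    have "inv r \<otimes> (y \<otimes> inv (\<nu> r s)) \<otimes> r \<in> N"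
      using a(3) b(3) rs by (intro N.inv_op_closed1) auto
    then have "a \<otimes> inv b \<in> N"
      unfolding eq using a b rs by (simp add: m_assoc)
    then have "a \<otimes> inv b \<in> generate G S"
      unfolding S(3) using a b by simp
    have conj: "r \<otimes> z \<otimes> inv r \<in> ?M" if "z \<in> S" for z
      using that rR unfolding Z_def by (intro generate.incl UnI1 image_eqI[of _ _ "(r, z)"]) auto
    have "S \<subseteq> carrier G"
      using S(2) A.subset by blast
    from generate_conjugate[OF this rs(1) M.subgroup_axioms conj \<open>a \<otimes> inv b \<in> generate G S\<close>]
    have "r \<otimes> (a \<otimes> inv b) \<otimes> inv r \<in> ?M" .
    then have "y \<otimes> inv (\<nu> r s) \<otimes> \<nu> r s \<in> ?M"
      unfolding eq using \<nu>M by (rule M.m_closed)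
    then show ?thesis
      using a b rs by (simp add: inv_mult_group m_assoc)
  qed
  \<comment> \<open>The translates of the vertices in \<open>R\<close> by the generated subgroup are closed under passing to neighbours, so they exhaust the tree.\<close>
  have cover: "\<exists>m\<in>?M. \<exists>r\<in>R. \<exists>a\<in>A. g = m \<otimes> r \<otimes> a" if "g \<in> carrier G" for g
    using that
  proof (induction rule: generation_induct)
    case one
    have "\<one> = \<one> \<otimes> \<one> \<otimes> \<one>" by simp
    then show ?case
      using R(3) A.one_closed M.one_closed by blast
  next
    case (base g b)
    then obtain m r a where g: "m \<in> ?M" "r \<in> R" "a \<in> A" "g = m \<otimes> r \<otimes> a" by blast
    then have "r \<in> carrier G" using R(2) by blast
    then have "g \<otimes> b = m \<otimes> r \<otimes> (a \<otimes> b)"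
      using g(3,4) base(2) M.mem_carrier[OF g(1)] by (simp add: m_assoc)
    moreover have "a \<otimes> b \<in> A" using g base(2) by simp
    ultimately show ?case using g by blast
  next
    case (stable g)
    then obtain m r a where g: "m \<in> ?M" "r \<in> R" "a \<in> A" "g = m \<otimes> r \<otimes> a" by blast
    then have rc: "r \<in> carrier G" using R(2) by blast
    obtain n q c where e: "n \<in> N" "q \<in> Q" "c \<in> C" "r \<otimes> a \<otimes> t = n \<otimes> q \<otimes> c"
      using bspec[OF Q(3), of "r \<otimes> a \<otimes> t"] rc g(3) by auto
    then have qc: "q \<in> carrier G" using Q(2) by blast
    have d: "t \<otimes> c \<otimes> inv t \<in> A"
      using stable_conj[OF e(3)] phi_closed[OF e(3)] by simp
    have "n = (n \<otimes> q \<otimes> c) \<otimes> inv c \<otimes> inv q"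
      using e qc by (simp add: m_assoc)
    also have "\<dots> = r \<otimes> (a \<otimes> inv (t \<otimes> c \<otimes> inv t)) \<otimes> inv (q \<otimes> inv t)"
      unfolding e(4)[symmetric] using rc qc g(3) e(3) by (simp add: inv_mult_group m_assoc)
    finally have "link r (q \<otimes> inv t) n"
      unfolding link_def using e(1) g(3) d by blast
    then have "n \<in> ?M"
      using g(2) e(2) by (intro link_M[of r "q \<otimes> inv t"]) (auto simp: R_def)
    moreover have "g \<otimes> t = (m \<otimes> n) \<otimes> q \<otimes> c"
      using e g rc qc M.mem_carrier[OF g(1)] by (simp add: m_assoc)
    moreover have "q \<in> R" "c \<in> A"
      using e subgroups(1) by (auto simp: R_def)
    ultimately show ?case
      using M.m_closed[OF g(1)] by blast
  next
    case (stable_inv g)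
    then obtain m r a where g: "m \<in> ?M" "r \<in> R" "a \<in> A" "g = m \<otimes> r \<otimes> a" by blast
    then have rc: "r \<in> carrier G" using R(2) by blast
    obtain n q c where e: "n \<in> N" "q \<in> Q" "c \<in> C" "r \<otimes> a = n \<otimes> q \<otimes> c"
      using bspec[OF Q(3), of "r \<otimes> a"] rc g(3) by auto
    then have qc: "q \<in> carrier G" using Q(2) by blast
    have d: "t \<otimes> c \<otimes> inv t \<in> A"
      using stable_conj[OF e(3)] phi_closed[OF e(3)] by simp
    have cA: "c \<in> A" using e(3) subgroups(1) by blast
    have "n = (n \<otimes> q \<otimes> c) \<otimes> inv c \<otimes> inv q"
      using e qc by (simp add: m_assoc)
    also have "\<dots> = r \<otimes> (a \<otimes> inv c) \<otimes> inv q"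
      unfolding e(4)[symmetric] using rc qc g(3) e(3) by (simp add: m_assoc)
    finally have "link r q n"
      unfolding link_def using e(1) g(3) cA by blast
    then have "n \<in> ?M"
      using g(2) e(2) by (intro link_M[of r q]) (auto simp: R_def)
    moreover have "g \<otimes> inv t = m \<otimes> (n \<otimes> q \<otimes> c) \<otimes> inv t"
      unfolding e(4)[symmetric] using g rc M.mem_carrier[OF g(1)] by (simp add: m_assoc)
    then have "g \<otimes> inv t = (m \<otimes> n) \<otimes> (q \<otimes> inv t) \<otimes> (t \<otimes> c \<otimes> inv t)"
      using e qc M.mem_carrier[OF g(1)] by (simp add: m_assoc)
    moreover have "q \<otimes> inv t \<in> R"
      using e by (auto simp: R_def)
    ultimately show ?case
      using M.m_closed[OF g(1)] d by blast
  qed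
  have "N \<subseteq> ?M"
  proof
    fix n assume n: "n \<in> N"
    obtain m r a where g: "m \<in> ?M" "r \<in> R" "a \<in> A" "n = m \<otimes> r \<otimes> a"
      using cover[of n] n by auto
    then have rc: "r \<in> carrier G" using R(2) by blast
    have mN: "m \<in> N" using g(1) MN by blast
    have "inv m \<otimes> n = r \<otimes> a \<otimes> inv \<one>"
      using g rc mN by (simp add: m_assoc)
    moreover have "inv m \<otimes> n \<in> N"
      using mN n by simp
    ultimately have "link r \<one> (inv m \<otimes> n)"
      unfolding link_def using g(3) by blast
    then have "inv m \<otimes> n \<in> ?M"
      using link_M g(2) R(3) by blast
    then have "m \<otimes> (inv m \<otimes> n) \<in> ?M"
      by (rule M.m_closed[OF g(1)])
    then show "n \<in> ?M"
      using mN n by simp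
  qed
  then have "?M = N" using MN by blast
  then show ?thesis
    using Z finitely_generated_subgroup_iff[OF N.subgroup_axioms] by blast
qed

end

section \<open>Exchanging cosets\<close>

text \<open>
  The disjoint union of \<open>P\G\<close> and \<open>N\G\<close> is encoded by the two summands of a sum type, which keeps
  them apart even if \<open>P = N\<close>.
\<close>

abbreviation (in group) translate :: "'a \<Rightarrow> 'a set + 'a set \<Rightarrow> 'a set + 'a set" where
  "translate g \<equiv> map_sum (\<lambda>X. X #> g) (\<lambda>Y. Y #> g)"

abbreviation (in group) coset_pairs :: "'a set \<Rightarrow> 'a set \<Rightarrow> ('a set + 'a set) set" where
  "coset_pairs P N \<equiv> Inl ` (rcosets P) \<union> Inr ` (rcosets N)"

text \<open>
  Let \<open>P \<le> N\<close> and let \<open>B\<close> be a further subgroup. On the disjoint union of \<open>P\G\<close> and \<open>N\G\<close>, on which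
  \<open>G\<close> acts by right translation, the cosets \<open>Pib\<close> and \<open>Nib\<close> with \<open>i \<in> I\<close> and \<open>b \<in> B\<close> can be
  interchanged by a \<open>B\<close>-equivariant involution, as soon as the elements of \<open>I\<close> represent distinct
  double cosets of \<open>N\<close> and \<open>B\<close> and \<open>P\<close> contains the groups \<open>N \<inter> iBi\<^sup>-\<^sup>1\<close>.
\<close>

locale coset_exchange = N: normal N G + P: subgroup P G + B: subgroup B G
  for G (structure) and N P B + fixes I
  assumes P_le_N: "P \<subseteq> N" and I_carrier: "I \<subseteq> carrier G"
    and separated: "\<lbrakk>i \<in> I; j \<in> I; b \<in> B; b' \<in> B; N #> (i \<otimes> b) = N #> (j \<otimes> b')\<rbrakk> \<Longrightarrow> i = j"
    and stabilizer: "\<lbrakk>i \<in> I; b \<in> B; i \<otimes> b \<otimes> inv i \<in> N\<rbrakk> \<Longrightarrow> i \<otimes> b \<otimes> inv i \<in> P"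
begin

text \<open>
  The cosets of \<open>P\<close> that are interchanged with cosets of \<open>N\<close>; the coset of \<open>N\<close> belonging to \<open>X\<close> is
  \<open>NX\<close>.
\<close>

definition moved :: "'a set set" where
  "moved = {P #> (i \<otimes> b) | i b. i \<in> I \<and> b \<in> B}"

text \<open>
  The involution. It fixes all cosets that are not of the form \<open>Pib\<close> or \<open>Nib\<close>.
\<close>

definition exchange :: "'a set + 'a set \<Rightarrow> 'a set + 'a set" where
  "exchange \<omega> = (case \<omega> of
     Inl X \<Rightarrow> if X \<in> moved then Inr (N <#> X) else Inl X
   | Inr Y \<Rightarrow> if Y \<in> (\<lambda>X. N <#> X) ` moved then Inl (inv_into moved (\<lambda>X. N <#> X) Y) else Inr Y)"

lemma I_closed: "i \<in> I \<Longrightarrow> i \<in> carrier G"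
  using I_carrier by blast

lemma N_times_coset: "g \<in> carrier G \<Longrightarrow> N <#> (P #> g) = N #> g"
proof -
  assume g: "g \<in> carrier G"
  have "N <#> P = N"
  proof
    show "N <#> P \<subseteq> N"
      using P_le_N by (auto simp: set_mult_def)
    show "N \<subseteq> N <#> P"
    proof
      fix n assume "n \<in> N"
      then show "n \<in> N <#> P"
        using N.mem_set_multI[OF \<open>n \<in> N\<close> P.one_closed] by simp
    qed
  qed
  then show ?thesis
    using g by (simp add: N.setmult_rcos_assoc N.subset P.subset)
qed

lemma inj_on_moved: "inj_on (\<lambda>X. N <#> X) moved"
proof (rule inj_onI)
  fix X Y assume "X \<in> moved" "Y \<in> moved" and eq: "N <#> X = N <#> Y"
  then obtain i b j b' where X: "X = P #> (i \<otimes> b)" "i \<in> I" "b \<in> B"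
    and Y: "Y = P #> (j \<otimes> b')" "j \<in> I" "b' \<in> B"
    by (auto simp: moved_def)
  have "N #> (i \<otimes> b) = N #> (j \<otimes> b')"
    using eq X Y I_closed by (simp add: N_times_coset)
  moreover from this have "i = j"
    using separated X Y by blast
  ultimately have "(i \<otimes> b) \<otimes> inv (i \<otimes> b') \<in> N"
    using N.r_coset_eq_iff[OF N.subgroup_axioms, of "i \<otimes> b" "i \<otimes> b'"] X Y I_closed by simp
  then have "i \<otimes> (b \<otimes> inv b') \<otimes> inv i \<in> N"
    using X Y I_closed by (simp add: N.inv_mult_group N.m_assoc)
  then have "i \<otimes> (b \<otimes> inv b') \<otimes> inv i \<in> P"
    using stabilizer[of i "b \<otimes> inv b'"] X Y by simp
  then have "(i \<otimes> b) \<otimes> inv (i \<otimes> b') \<in> P"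
    using X Y I_closed by (simp add: N.inv_mult_group N.m_assoc)
  then show "X = Y"
    using N.r_coset_eq_iff[OF P.subgroup_axioms, of "i \<otimes> b" "i \<otimes> b'"] X Y I_closed \<open>i = j\<close> by simp
qed

lemma exchange_moved:
  assumes "i \<in> I" "b \<in> B"
  shows "exchange (Inl (P #> (i \<otimes> b))) = Inr (N #> (i \<otimes> b))"
    and "exchange (Inr (N #> (i \<otimes> b))) = Inl (P #> (i \<otimes> b))"
proof -
  have m: "P #> (i \<otimes> b) \<in> moved" and eq: "N <#> (P #> (i \<otimes> b)) = N #> (i \<otimes> b)"
    using assms I_closed by (auto simp: moved_def intro!: N_times_coset)
  show "exchange (Inl (P #> (i \<otimes> b))) = Inr (N #> (i \<otimes> b))"
    using m eq by (simp add: exchange_def)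
  have "N #> (i \<otimes> b) \<in> (\<lambda>X. N <#> X) ` moved"
    using m eq by (metis image_eqI)
  moreover have "inv_into moved (\<lambda>X. N <#> X) (N #> (i \<otimes> b)) = P #> (i \<otimes> b)"
    using inv_into_f_f[OF inj_on_moved m] eq by simp
  ultimately show "exchange (Inr (N #> (i \<otimes> b))) = Inl (P #> (i \<otimes> b))"
    by (simp add: exchange_def)
qed

lemma exchange_fixed:
  shows "\<lbrakk>\<And>i b. \<lbrakk>i \<in> I; b \<in> B\<rbrakk> \<Longrightarrow> X \<noteq> P #> (i \<otimes> b)\<rbrakk> \<Longrightarrow> exchange (Inl X) = Inl X"
    and "\<lbrakk>\<And>i b. \<lbrakk>i \<in> I; b \<in> B\<rbrakk> \<Longrightarrow> Y \<noteq> N #> (i \<otimes> b)\<rbrakk> \<Longrightarrow> exchange (Inr Y) = Inr Y"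
proof -
  assume "\<And>i b. \<lbrakk>i \<in> I; b \<in> B\<rbrakk> \<Longrightarrow> X \<noteq> P #> (i \<otimes> b)"
  then have "X \<notin> moved" by (auto simp: moved_def)
  then show "exchange (Inl X) = Inl X" by (simp add: exchange_def)
next
  assume *: "\<And>i b. \<lbrakk>i \<in> I; b \<in> B\<rbrakk> \<Longrightarrow> Y \<noteq> N #> (i \<otimes> b)"
  have "Y \<noteq> N <#> X" if X: "X \<in> moved" for X
  proof -
    obtain i b where ib: "i \<in> I" "b \<in> B" "X = P #> (i \<otimes> b)"
      using X by (auto simp: moved_def)
    then have "N <#> X = N #> (i \<otimes> b)"
      using I_closed by (auto intro!: N_times_coset)
    then show ?thesis
      using *[OF ib(1,2)] by simp
  qed
  then have "Y \<notin> (\<lambda>X. N <#> X) ` moved" by blast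
  then show "exchange (Inr Y) = Inr Y" by (simp add: exchange_def)
qed

lemma exchange_cases:
  obtains (moved_P) i b where "i \<in> I" "b \<in> B" "\<omega> = Inl (P #> (i \<otimes> b))"
  | (moved_N) i b where "i \<in> I" "b \<in> B" "\<omega> = Inr (N #> (i \<otimes> b))"
  | (fixed_P) X where "\<omega> = Inl X" "\<forall>i\<in>I. \<forall>b\<in>B. X \<noteq> P #> (i \<otimes> b)"
  | (fixed_N) Y where "\<omega> = Inr Y" "\<forall>i\<in>I. \<forall>b\<in>B. Y \<noteq> N #> (i \<otimes> b)"
proof (cases \<omega>)
  case (Inl X)
  then show thesis
    using moved_P fixed_P by (cases "\<exists>i\<in>I. \<exists>b\<in>B. X = P #> (i \<otimes> b)") auto
next
  case (Inr Y)
  then show thesis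
    using moved_N fixed_N by (cases "\<exists>i\<in>I. \<exists>b\<in>B. Y = N #> (i \<otimes> b)") auto
qed

lemma exchange_exchange [simp]: "exchange (exchange \<omega>) = \<omega>"
  by (cases \<omega> rule: exchange_cases) (simp_all add: exchange_moved exchange_fixed)

lemma translate_coset:
  assumes "subgroup H G" "g \<in> carrier G" "h \<in> carrier G"
  shows "(H #> g) #> h = H #> (g \<otimes> h)"
  using assms by (simp add: N.coset_mult_assoc subgroup.subset)

lemma mem_cosets_cases:
  assumes "\<omega> \<in> N.coset_pairs P N"
  obtains (P) g where "g \<in> carrier G" "\<omega> = Inl (P #> g)"
  | (N) g where "g \<in> carrier G" "\<omega> = Inr (N #> g)"
  using assms by (auto simp: RCOSETS_def)

lemma coset_mem_cosets: "g \<in> carrier G \<Longrightarrow> Inl (P #> g) \<in> N.coset_pairs P N" "g \<in> carrier G \<Longrightarrow> Inr (N #> g) \<in> N.coset_pairs P N"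
  by (auto simp: RCOSETS_def)

lemma translate_closed: "\<lbrakk>\<omega> \<in> N.coset_pairs P N; g \<in> carrier G\<rbrakk> \<Longrightarrow> N.translate g \<omega> \<in> N.coset_pairs P N"
  by (erule mem_cosets_cases)
    (simp_all add: translate_coset[OF P.subgroup_axioms] translate_coset[OF N.subgroup_axioms] coset_mem_cosets del: Un_iff)

lemma translate_mult:
  "\<lbrakk>\<omega> \<in> N.coset_pairs P N; g \<in> carrier G; h \<in> carrier G\<rbrakk> \<Longrightarrow> N.translate h (N.translate g \<omega>) = N.translate (g \<otimes> h) \<omega>"
  by (erule mem_cosets_cases)
    (simp_all add: translate_coset[OF P.subgroup_axioms] translate_coset[OF N.subgroup_axioms] N.m_assoc)

lemma translate_one: "\<omega> \<in> N.coset_pairs P N \<Longrightarrow> N.translate \<one> \<omega> = \<omega>"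
  by (erule mem_cosets_cases)
    (simp_all add: translate_coset[OF P.subgroup_axioms] translate_coset[OF N.subgroup_axioms])

lemma exchange_closed:
  assumes "\<omega> \<in> N.coset_pairs P N" shows "exchange \<omega> \<in> N.coset_pairs P N"
  using assms
  by (cases \<omega> rule: exchange_cases)
    (simp_all add: exchange_moved exchange_fixed coset_mem_cosets I_closed del: Un_iff)

lemma exchange_translate:
  assumes \<omega>: "\<omega> \<in> N.coset_pairs P N" and b: "b \<in> B"
  shows "exchange (N.translate b \<omega>) = N.translate b (exchange \<omega>)"
proof -
  have shift: "\<exists>j\<in>I. \<exists>c\<in>B. H #> g = H #> (j \<otimes> c)"
    if "subgroup H G" "g \<in> carrier G" "i \<in> I" "c \<in> B" "H #> (g \<otimes> b) = H #> (i \<otimes> c)" for H g i c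
  proof -
    have "(H #> (g \<otimes> b)) #> inv b = (H #> (i \<otimes> c)) #> inv b"
      using that(5) by simp
    then have "H #> g = H #> (i \<otimes> (c \<otimes> inv b))"
      using that(1-4) b I_closed by (simp add: translate_coset N.m_assoc)
    then show ?thesis
      using that b by (meson B.m_closed B.m_inv_closed)
  qed
  note tr = translate_coset[OF P.subgroup_axioms] translate_coset[OF N.subgroup_axioms]
  show ?thesis
  proof (cases \<omega> rule: exchange_cases)
    case (moved_P i c)
    then show ?thesis
      using b I_closed exchange_moved[of i c] exchange_moved[of i "c \<otimes> b"] by (simp add: tr N.m_assoc)
  next
    case (moved_N i c)
    then show ?thesis
      using b I_closed exchange_moved[of i c] exchange_moved[of i "c \<otimes> b"] by (simp add: tr N.m_assoc)
  next
    case (fixed_P X)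
    then obtain g where g: "g \<in> carrier G" "X = P #> g"
      using \<omega> by (auto simp: RCOSETS_def)
    have "P #> (g \<otimes> b) \<noteq> P #> (i \<otimes> c)" if "i \<in> I" "c \<in> B" for i c
      using shift[OF P.subgroup_axioms g(1) that] fixed_P(2) g(2) by blast
    then show ?thesis
      using fixed_P g b by (simp add: exchange_fixed tr)
  next
    case (fixed_N Y)
    then obtain g where g: "g \<in> carrier G" "Y = N #> g"
      using \<omega> by (auto simp: RCOSETS_def)
    have "N #> (g \<otimes> b) \<noteq> N #> (i \<otimes> c)" if "i \<in> I" "c \<in> B" for i c
      using shift[OF N.subgroup_axioms g(1) that] fixed_N(2) g(2) by blast
    then show ?thesis
      using fixed_N g b by (simp add: exchange_fixed tr)
  qed
qed

end

context hnn_normal_subgroup begin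

section \<open>Generators of \<open>N \<inter> A\<close>\<close>

text \<open>
  Representatives of the double cosets \<open>(N \<inter> A)xB\<close> in \<open>A\<close>.
\<close>

definition transversal :: "'a set \<Rightarrow> 'a set \<Rightarrow> bool" where
  "transversal B I \<longleftrightarrow> I \<subseteq> A \<and> (\<forall>a\<in>A. \<exists>i\<in>I. \<exists>b\<in>B. N #> a = N #> (i \<otimes> b)) \<and>
     (\<forall>i\<in>I. \<forall>j\<in>I. \<forall>b\<in>B. \<forall>b'\<in>B. N #> (i \<otimes> b) = N #> (j \<otimes> b') \<longrightarrow> i = j)"

lemma N_coset_mult:
  assumes "N #> x = N #> y" "x \<in> carrier G" "y \<in> carrier G" "z \<in> carrier G"
  shows "N #> (x \<otimes> z) = N #> (y \<otimes> z)"
  using assms by (metis coset_mult_assoc N.subset)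

lemma transversal_exists:
  assumes B: "subgroup B G" "B \<subseteq> A" and Q: "finite Q" "Q \<subseteq> carrier G"
    "\<forall>g\<in>carrier G. \<exists>n\<in>N. \<exists>q\<in>Q. \<exists>b\<in>B. g = n \<otimes> q \<otimes> b"
  obtains I where "finite I" "transversal B I"
proof -
  interpret B: subgroup B G by fact
  interpret A: subgroup A G by (rule subgroup_A)
  define rel where "rel x y \<longleftrightarrow> (\<exists>b\<in>B. N #> x = N #> (y \<otimes> b))" for x y
  have rel_sym: "rel y x" if r: "rel x y" and "x \<in> carrier G" "y \<in> carrier G" for x y
  proof -
    obtain b where b: "b \<in> B" "N #> x = N #> (y \<otimes> b)"
      using r by (auto simp: rel_def)
    then have "N #> (x \<otimes> inv b) = N #> (y \<otimes> b \<otimes> inv b)"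
      using that by (intro N_coset_mult) auto
    then show ?thesis
      using b that by (auto simp: rel_def m_assoc intro!: bexI[of _ "inv b"])
  qed
  have rel_trans: "rel x z" if r: "rel x y" "rel y z" and "x \<in> carrier G" "y \<in> carrier G" "z \<in> carrier G" for x y z
  proof -
    obtain b c where b: "b \<in> B" "N #> x = N #> (y \<otimes> b)" "c \<in> B" "N #> y = N #> (z \<otimes> c)"
      using r by (auto simp: rel_def)
    then have "N #> (y \<otimes> b) = N #> (z \<otimes> c \<otimes> b)"
      using that by (intro N_coset_mult) auto
    then show ?thesis
      using b that by (auto simp: rel_def m_assoc intro!: bexI[of _ "c \<otimes> b"])
  qed
  define E where "E q = {x \<in> A. rel x q}" for q
  define pick where "pick q = (SOME x. x \<in> E q)" for q
  have pick: "pick q \<in> E q" if "x \<in> E q" for x q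
    unfolding pick_def using that by (rule someI)
  define I where "I = pick ` {q \<in> Q. E q \<noteq> {}}"
  have covers: "\<exists>i\<in>I. \<exists>b\<in>B. N #> a = N #> (i \<otimes> b)" if a: "a \<in> A" for a
  proof -
    obtain n q b where e: "n \<in> N" "q \<in> Q" "b \<in> B" "a = n \<otimes> q \<otimes> b"
      using bspec[OF Q(3), of a] a by auto
    then have q: "q \<in> carrier G" using Q(2) by blast
    have "a \<otimes> inv (q \<otimes> b) = n"
      using e q by (simp add: inv_mult_group m_assoc)
    then have "N #> a = N #> (q \<otimes> b)"
      using r_coset_eq_iff[OF N.subgroup_axioms, of a "q \<otimes> b"] e(1,3) a q by simp
    then have aq: "rel a q"
      unfolding rel_def using e(3) by (rule bexI)
    then have aE: "a \<in> E q"
      using a by (simp add: E_def)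
    then have pE: "pick q \<in> E q" by (rule pick)
    then have p: "rel (pick q) q" "pick q \<in> carrier G"
      by (simp_all add: E_def A.mem_carrier)
    have ac: "a \<in> carrier G" using a by simp
    have "rel a (pick q)"
      by (rule rel_trans[OF aq rel_sym[OF p q] ac q p(2)])
    moreover have "pick q \<in> I"
      unfolding I_def using e(2) aE by blast
    ultimately show ?thesis
      unfolding rel_def by (rule_tac bexI)
  qed
  have separates: "i = j" if ij: "i \<in> I" "j \<in> I" and b: "b \<in> B" "b' \<in> B" and eq: "N #> (i \<otimes> b) = N #> (j \<otimes> b')"
    for i j b b'
  proof -
    obtain q where q: "q \<in> Q" "E q \<noteq> {}" "i = pick q" using ij(1) by (auto simp: I_def)
    obtain r where r: "r \<in> Q" "E r \<noteq> {}" "j = pick r" using ij(2) by (auto simp: I_def)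
    have qr: "q \<in> carrier G" "r \<in> carrier G" using q r Q(2) by auto
    have "i \<in> E q" "j \<in> E r" using q(2,3) r(2,3) pick by auto
    then have i: "rel i q" "rel j r" "i \<in> carrier G" "j \<in> carrier G"
      by (simp_all add: E_def A.mem_carrier)
    have "N #> (i \<otimes> b \<otimes> inv b) = N #> (j \<otimes> b' \<otimes> inv b)"
      using eq i b by (intro N_coset_mult) auto
    then have "rel i j"
      using i b by (auto simp: rel_def m_assoc intro!: bexI[of _ "b' \<otimes> inv b"])
    from rel_trans[OF this i(2,3,4) qr(2)] have "rel i r" .
    from rel_trans[OF rel_sym[OF i(1,3) qr(1)] this qr(1) i(3) qr(2)] have rel_qr: "rel q r" .
    have iff: "rel x q \<longleftrightarrow> rel x r" if "x \<in> A" for x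
      using rel_trans[OF _ rel_qr A.mem_carrier[OF that] qr]
        rel_trans[OF _ rel_sym[OF rel_qr qr] A.mem_carrier[OF that] qr(2,1)] by (rule iffI)
    have "E q = E r"
      unfolding E_def by (auto simp: iff)
    then show "i = j"
      using q(3) r(3) by (simp add: pick_def)
  qed
  have "I \<subseteq> A"
  proof
    fix i assume "i \<in> I"
    then obtain q where "E q \<noteq> {}" "i = pick q" by (auto simp: I_def)
    then have "i \<in> E q" using pick by auto
    then show "i \<in> A" by (simp add: E_def)
  qed
  have "transversal B I"
    unfolding transversal_def
  proof (intro conjI ballI impI)
    show "I \<subseteq> A" by fact
  next
    fix a assume "a \<in> A"
    then show "\<exists>i\<in>I. \<exists>b\<in>B. N #> a = N #> (i \<otimes> b)" by (rule covers)
  next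
    fix i j b b' assume "i \<in> I" "j \<in> I" "b \<in> B" "b' \<in> B" "N #> (i \<otimes> b) = N #> (j \<otimes> b')"
    then show "i = j" by (rule separates)
  qed
  moreover have "finite I"
    unfolding I_def using Q(1) by simp
  ultimately show thesis
    by (rule_tac that)
qed

text \<open>
  The relation \<open>tct\<^sup>-\<^sup>1 = \<phi>(c)\<close> holds since one exchange commutes with \<open>C\<close> and the other with \<open>D\<close>.
\<close>

lemma exchange_action:
  assumes "coset_exchange G N P C I" "coset_exchange G N P D J"
  obtains act where
    "\<forall>g\<in>carrier G. \<forall>\<omega>\<in>coset_pairs P N. act g \<omega> \<in> coset_pairs P N"
    "\<forall>g\<in>carrier G. \<forall>h\<in>carrier G. \<forall>\<omega>\<in>coset_pairs P N. act (g \<otimes> h) \<omega> = act h (act g \<omega>)"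
    "\<forall>\<omega>\<in>coset_pairs P N. act \<one> \<omega> = \<omega>"
    "\<forall>a\<in>A. \<forall>\<omega>\<in>coset_pairs P N. act a \<omega> = translate a \<omega>"
    "\<forall>\<omega>\<in>coset_pairs P N. act t \<omega> =
       coset_exchange.exchange G N P C I (translate t (coset_exchange.exchange G N P D J \<omega>))"
    "\<forall>\<omega>\<in>coset_pairs P N. act (inv t) \<omega> =
       coset_exchange.exchange G N P D J (translate (inv t) (coset_exchange.exchange G N P C I \<omega>))"
proof -
  interpret EC: coset_exchange G N P C I by fact
  interpret ED: coset_exchange G N P D J by fact
  let ?X = "coset_pairs P N"
  let ?\<tau> = "\<lambda>\<omega>. EC.exchange (translate t (ED.exchange \<omega>))"
  let ?\<tau>' = "\<lambda>\<omega>. ED.exchange (translate (inv t) (EC.exchange \<omega>))"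
  have A: "a \<in> carrier G" if "a \<in> A" for a
    using subgroups(3) that by blast
  note closed = EC.exchange_closed ED.exchange_closed EC.translate_closed
  have 1: "translate a \<omega> \<in> ?X" if "a \<in> A" "\<omega> \<in> ?X" for a \<omega>
    using that A by (intro closed)
  have 2: "?\<tau> \<omega> \<in> ?X" "?\<tau>' \<omega> \<in> ?X" if "\<omega> \<in> ?X" for \<omega>
    by (intro closed that stable_closed inv_closed)+
  have 3: "translate (a \<otimes> b) \<omega> = translate b (translate a \<omega>)" if "a \<in> A" "b \<in> A" "\<omega> \<in> ?X" for a b \<omega>
    using EC.translate_mult[OF that(3) A[OF that(1)] A[OF that(2)]] by simp
  have 4: "?\<tau>' (?\<tau> \<omega>) = \<omega>" "?\<tau> (?\<tau>' \<omega>) = \<omega>" if "\<omega> \<in> ?X" for \<omega>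
    using EC.translate_mult[OF closed(2)[OF that] stable_closed inv_closed[OF stable_closed]]
      EC.translate_mult[OF closed(1)[OF that] inv_closed[OF stable_closed] stable_closed]
      EC.translate_one[OF closed(2)[OF that]] EC.translate_one[OF closed(1)[OF that]]
    by (simp_all del: Un_iff)
  have 5: "?\<tau>' (translate c (?\<tau> \<omega>)) = translate (\<phi> c) \<omega>" if c: "c \<in> C" and \<omega>: "\<omega> \<in> ?X" for c \<omega>
  proof -
    have cc: "c \<in> carrier G" "\<phi> c \<in> D"
      using c phi_image by auto
    let ?\<eta> = "ED.exchange \<omega>"
    have \<eta>: "?\<eta> \<in> ?X" by (rule closed(2)[OF \<omega>])
    have "EC.exchange (translate c (?\<tau> \<omega>)) = translate c (EC.exchange (?\<tau> \<omega>))"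
      using EC.exchange_translate[OF 2(1)[OF \<omega>] c] .
    also have "\<dots> = translate c (translate t ?\<eta>)"
      by simp
    also have "\<dots> = translate (t \<otimes> c) ?\<eta>"
      by (rule EC.translate_mult[OF \<eta> stable_closed cc(1)])
    finally have "?\<tau>' (translate c (?\<tau> \<omega>)) = ED.exchange (translate (inv t) (translate (t \<otimes> c) ?\<eta>))"
      by simp
    also have "\<dots> = ED.exchange (translate (\<phi> c) ?\<eta>)"
      using EC.translate_mult[OF \<eta>, of "t \<otimes> c" "inv t"] cc(1) stable_conj[OF c] by simp
    also have "\<dots> = translate (\<phi> c) (ED.exchange ?\<eta>)"
      by (rule ED.exchange_translate[OF \<eta> cc(2)])
    finally show ?thesis by simp
  qed
  show thesis
    by (rule right_action[of ?X translate ?\<tau> ?\<tau>', OF 1 2 EC.translate_one 3 4 5]) (assumption | rule that)+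
qed

text \<open>
  The coset to which the base point \<open>P\<close> is moved by \<open>g\<close>, provided that \<open>P\<close> is large enough for \<open>g\<close>:
  it is \<open>Ng\<close> unless \<open>g \<in> NA\<close>, and then it is \<open>Pa\<close> for some \<open>a \<in> A\<close> with \<open>Na = Ng\<close>.
\<close>

definition tracked :: "'a set \<Rightarrow> 'a \<Rightarrow> 'a \<Rightarrow> 'a set + 'a set" where
  "tracked P a g = (if g \<in> N <#> A then Inl (P #> a) else Inr (N #> g))"

lemma mem_NA_iff:
  assumes "g \<in> carrier G"
  shows "g \<in> N <#> A \<longleftrightarrow> (\<exists>a\<in>A. N #> a = N #> g)"
proof
  assume "g \<in> N <#> A"
  then obtain n a where na: "n \<in> N" "a \<in> A" "g = n \<otimes> a" by (rule mem_set_multE)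
  then have ac: "a \<in> carrier G" using subgroups(3) by blast
  have "N #> g = N #> a"
    using na ac r_coset_eq_iff[OF N.subgroup_axioms, of g a] by (simp add: m_assoc)
  then show "\<exists>a\<in>A. N #> a = N #> g" using na(2) by auto
next
  assume "\<exists>a\<in>A. N #> a = N #> g"
  then obtain a where a: "a \<in> A" "N #> g = N #> a" by auto
  then have ac: "a \<in> carrier G" using subgroups(3) by blast
  have "g \<otimes> inv a \<in> N"
    using a(2) ac assms r_coset_eq_iff[OF N.subgroup_axioms, of g a] by simp
  then have "g \<otimes> inv a \<otimes> a \<in> N <#> A"
    using a(1) by (rule mem_set_multI)
  then show "g \<in> N <#> A"
    using ac assms by (simp add: m_assoc)
qed

lemma exchange_fixed_off_NA:
  assumes tv: "transversal B I" and B: "B \<subseteq> A" and g: "g \<in> carrier G" "g \<notin> N <#> A"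
    and "coset_exchange G N P B I"
  shows "coset_exchange.exchange G N P B I (Inr (N #> g)) = Inr (N #> g)"
proof -
  interpret E: coset_exchange G N P B I by fact
  interpret A: subgroup A G by (rule subgroup_A)
  have "N #> g \<noteq> N #> (i \<otimes> b)" if "i \<in> I" "b \<in> B" for i b
  proof
    assume eq: "N #> g = N #> (i \<otimes> b)"
    have "i \<in> A" "b \<in> A" using that tv B unfolding transversal_def by auto
    then have "i \<otimes> b \<in> A" by simp
    then show False
      using g(2) eq mem_NA_iff[OF g(1)] by auto
  qed
  then show ?thesis
    by (rule E.exchange_fixed(2))
qed

text \<open>
  The exchange takes \<open>Pa\<close> to \<open>Na\<close> if \<open>a\<close> is one of the elements \<open>ib\<close>. In general \<open>a = xib\<close> with
  \<open>x \<in> N \<inter> A\<close>, and it suffices that \<open>x \<in> P\<close>.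
\<close>

lemma exchange_tracked:
  assumes tv: "transversal B I" and B: "B \<subseteq> A" and g: "g \<in> carrier G"
    and a: "g \<in> N <#> A \<longrightarrow> a \<in> A \<and> N #> a = N #> g"
  shows "\<exists>x\<in>N \<inter> A. \<forall>P. coset_exchange G N P B I \<and> x \<in> P \<longrightarrow>
    coset_exchange.exchange G N P B I (tracked P a g) = Inr (N #> g)"
proof (cases "g \<in> N <#> A")
  case True
  interpret A: subgroup A G by (rule subgroup_A)
  have aA: "a \<in> A" "N #> a = N #> g" using a True by auto
  obtain i b where ib: "i \<in> I" "b \<in> B" "N #> a = N #> (i \<otimes> b)"
    using tv aA(1) unfolding transversal_def by blast
  then have "i \<in> A" "b \<in> A"
    using tv B unfolding transversal_def by blast+
  then have ibA: "i \<otimes> b \<in> A" "i \<otimes> b \<in> carrier G" by simp_all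
  let ?x = "a \<otimes> inv (i \<otimes> b)"
  have "?x \<in> N"
    using r_coset_eq_iff[OF N.subgroup_axioms, of a "i \<otimes> b"] ib(3) aA ibA by simp
  moreover have "?x \<in> A"
    using aA ibA by simp
  moreover have "coset_exchange.exchange G N P B I (tracked P a g) = Inr (N #> g)"
    if "coset_exchange G N P B I" "?x \<in> P" for P
  proof -
    interpret E: coset_exchange G N P B I by fact
    have "P #> a = P #> (i \<otimes> b)"
      using r_coset_eq_iff[OF E.P.subgroup_axioms, of a "i \<otimes> b"] that(2) aA ibA by simp
    then show ?thesis
      using True E.exchange_moved(1)[OF ib(1,2)] ib(3) aA(2) by (simp add: tracked_def)
  qed
  ultimately show ?thesis by blast
next
  case False
  then show ?thesis
    using exchange_fixed_off_NA[OF tv B g] N.one_closed subgroup.one_closed[OF subgroup_A]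
    by (intro bexI[of _ \<one>]) (auto simp: tracked_def)
qed

lemma exchange_to_tracked:
  assumes tv: "transversal B I" and B: "B \<subseteq> A" and g: "g \<in> carrier G"
  shows "\<exists>a. (g \<in> N <#> A \<longrightarrow> a \<in> A \<and> N #> a = N #> g) \<and> (\<forall>P. coset_exchange G N P B I \<longrightarrow>
    coset_exchange.exchange G N P B I (Inr (N #> g)) = tracked P a g)"
proof (cases "g \<in> N <#> A")
  case True
  interpret A: subgroup A G by (rule subgroup_A)
  obtain a where aA: "a \<in> A" "N #> a = N #> g" using True mem_NA_iff[OF g] by auto
  obtain i b where ib: "i \<in> I" "b \<in> B" "N #> a = N #> (i \<otimes> b)"
    using tv aA(1) unfolding transversal_def by blast
  then have "i \<in> A" "b \<in> A"
    using tv B unfolding transversal_def by blast+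
  then have ibA: "i \<otimes> b \<in> A" by simp
  have "coset_exchange.exchange G N P B I (Inr (N #> g)) = tracked P (i \<otimes> b) g"
    if "coset_exchange G N P B I" for P
  proof -
    interpret E: coset_exchange G N P B I by fact
    show ?thesis
      using True E.exchange_moved(2)[OF ib(1,2)] ib(3) aA(2) by (simp add: tracked_def)
  qed
  then show ?thesis using ibA ib(3) aA(2) by auto
next
  case False
  then show ?thesis
    using exchange_fixed_off_NA[OF tv B g] by (auto simp: tracked_def)
qed

lemma exchange_translate_exchange_tracked:
  assumes B: "transversal B I" "B \<subseteq> A" and B': "transversal B' J" "B' \<subseteq> A"
    and g: "g \<in> carrier G" and s: "s \<in> carrier G"
    and a: "g \<in> N <#> A \<longrightarrow> a \<in> A \<and> N #> a = N #> g"
  shows "\<exists>x\<in>N \<inter> A. \<exists>a'. (g \<otimes> s \<in> N <#> A \<longrightarrow> a' \<in> A \<and> N #> a' = N #> (g \<otimes> s)) \<and>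
    (\<forall>P. coset_exchange G N P B I \<and> coset_exchange G N P B' J \<and> x \<in> P \<longrightarrow>
      coset_exchange.exchange G N P B' J
        (translate s (coset_exchange.exchange G N P B I (tracked P a g))) = tracked P a' (g \<otimes> s))"
proof -
  obtain x where x: "x \<in> N \<inter> A" "\<forall>P. coset_exchange G N P B I \<and> x \<in> P \<longrightarrow>
      coset_exchange.exchange G N P B I (tracked P a g) = Inr (N #> g)"
    using exchange_tracked[OF B g a] by (rule bexE)
  have gs: "g \<otimes> s \<in> carrier G" using g s by simp
  obtain a' where a': "(g \<otimes> s \<in> N <#> A \<longrightarrow> a' \<in> A \<and> N #> a' = N #> (g \<otimes> s)) \<and>
      (\<forall>P. coset_exchange G N P B' J \<longrightarrow>
        coset_exchange.exchange G N P B' J (Inr (N #> (g \<otimes> s))) = tracked P a' (g \<otimes> s))"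
    using exchange_to_tracked[OF B' gs] by (rule exE)
  have "N #> g #> s = N #> (g \<otimes> s)"
    using g s by (simp add: coset_mult_assoc N.subset)
  then show ?thesis
    using x a' by (intro bexI[of _ x] exI[of _ a']) simp_all
qed

text \<open>
  The orbit map of the base point \<open>P\<close> for the right action that is given by translation on \<open>A\<close>, and
  in which \<open>t\<close> and \<open>t\<^sup>-\<^sup>1\<close> act by translation between the two exchanges.
\<close>

definition orbit_map :: "'a set \<Rightarrow> 'a set \<Rightarrow> 'a set \<Rightarrow> ('a \<Rightarrow> 'a set + 'a set) \<Rightarrow> bool" where
  "orbit_map I J P \<psi> \<longleftrightarrow> coset_exchange G N P C I \<and> coset_exchange G N P D J \<and> \<psi> \<one> = Inl P \<and>
     (\<forall>g\<in>carrier G. (\<forall>a\<in>A. \<psi> (g \<otimes> a) = translate a (\<psi> g)) \<and>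
       \<psi> (g \<otimes> t) = coset_exchange.exchange G N P C I
         (translate t (coset_exchange.exchange G N P D J (\<psi> g))) \<and>
       \<psi> (g \<otimes> inv t) = coset_exchange.exchange G N P D J
         (translate (inv t) (coset_exchange.exchange G N P C I (\<psi> g))))"

text \<open>
  All that is needed of \<open>P\<close> for the base point to move as described to the coset belonging to a
  given element \<open>g\<close> is that \<open>P\<close> contains finitely many elements of \<open>N \<inter> A\<close>, one for each crossing
  on the way. Neither these elements nor the representative \<open>a\<close> depend on \<open>P\<close>.
\<close>

lemma trajectory:
  assumes I: "transversal C I" and J: "transversal D J" and g: "g \<in> carrier G"
  shows "\<exists>Z a. finite Z \<and> Z \<subseteq> N \<inter> A \<and> (g \<in> N <#> A \<longrightarrow> a \<in> A \<and> N #> a = N #> g) \<and>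
    (\<forall>P \<psi>. orbit_map I J P \<psi> \<and> Z \<subseteq> P \<longrightarrow> \<psi> g = tracked P a g)"
  using g
proof (induction rule: generation_induct)
  case one
  interpret A: subgroup A G by (rule subgroup_A)
  have mem: "\<one> \<in> N <#> A"
    using mem_NA_iff[of \<one>] A.one_closed by auto
  have "\<psi> \<one> = tracked P \<one> \<one>" if o: "orbit_map I J P \<psi>" for P \<psi>
  proof -
    interpret E: coset_exchange G N P C I using o by (simp add: orbit_map_def)
    show ?thesis
      using o mem E.P.subset by (simp add: tracked_def orbit_map_def)
  qed
  then show ?case
    by (intro exI[of _ "{}"] exI[of _ \<one>]) simp
next
  case (base g b)
  interpret A: subgroup A G by (rule subgroup_A)
  have bc: "b \<in> carrier G" using base(2) by simp
  obtain Z a where Za: "finite Z" "Z \<subseteq> N \<inter> A" "g \<in> N <#> A \<longrightarrow> a \<in> A \<and> N #> a = N #> g"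
    "\<forall>P \<psi>. orbit_map I J P \<psi> \<and> Z \<subseteq> P \<longrightarrow> \<psi> g = tracked P a g"
    using base(3) by (elim exE conjE)
  have iff: "g \<otimes> b \<in> N <#> A \<longleftrightarrow> g \<in> N <#> A"
  proof
    assume "g \<otimes> b \<in> N <#> A"
    then obtain n a where na: "n \<in> N" "a \<in> A" "g \<otimes> b = n \<otimes> a" by (rule mem_set_multE)
    have "g = (g \<otimes> b) \<otimes> inv b"
      using base(1) bc by (simp add: m_assoc)
    also have "\<dots> = n \<otimes> (a \<otimes> inv b)"
      unfolding na(3) using na(1,2) bc by (simp add: m_assoc)
    finally show "g \<in> N <#> A"
      using na(1,2) base(2) mem_set_multI[of n N "a \<otimes> inv b" A] by simp
  next
    assume "g \<in> N <#> A"
    then obtain n a where na: "n \<in> N" "a \<in> A" "g = n \<otimes> a" by (rule mem_set_multE)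
    then show "g \<otimes> b \<in> N <#> A"
      using base(2) mem_set_multI[of n N "a \<otimes> b" A] by (simp add: m_assoc)
  qed
  have "a \<otimes> b \<in> A \<and> N #> (a \<otimes> b) = N #> (g \<otimes> b)" if gb: "g \<otimes> b \<in> N <#> A"
  proof -
    have "a \<in> A" "N #> a = N #> g" using Za(3) gb iff by auto
    then show ?thesis
      using base(1,2) N_coset_mult[of a g b] by simp
  qed
  moreover have "\<psi> (g \<otimes> b) = tracked P (a \<otimes> b) (g \<otimes> b)" if o: "orbit_map I J P \<psi>" "Z \<subseteq> P" for P \<psi>
  proof -
    interpret E: coset_exchange G N P C I using o by (simp add: orbit_map_def)
    have "\<psi> g = tracked P a g"
      using Za(4) o by simp
    then have "\<psi> (g \<otimes> b) = translate b (tracked P a g)"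
      using o(1) base(1,2) by (simp add: orbit_map_def)
    also have "\<dots> = tracked P (a \<otimes> b) (g \<otimes> b)"
      using Za(3) base(1) bc E.translate_coset[OF E.P.subgroup_axioms, of a b]
        E.translate_coset[OF N.subgroup_axioms, of g b]
      by (simp add: tracked_def iff)
    finally show ?thesis .
  qed
  ultimately show ?case
    using Za(1,2) by (intro exI[of _ Z] exI[of _ "a \<otimes> b"]) simp
next
  case (stable g)
  obtain Z a where Za: "finite Z" "Z \<subseteq> N \<inter> A" "g \<in> N <#> A \<longrightarrow> a \<in> A \<and> N #> a = N #> g"
    "\<forall>P \<psi>. orbit_map I J P \<psi> \<and> Z \<subseteq> P \<longrightarrow> \<psi> g = tracked P a g"
    using stable(2) by (elim exE conjE)
  obtain x a' where x: "x \<in> N \<inter> A"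
    "g \<otimes> t \<in> N <#> A \<longrightarrow> a' \<in> A \<and> N #> a' = N #> (g \<otimes> t)"
    "\<forall>P. coset_exchange G N P D J \<and> coset_exchange G N P C I \<and> x \<in> P \<longrightarrow>
      coset_exchange.exchange G N P C I
        (translate t (coset_exchange.exchange G N P D J (tracked P a g))) = tracked P a' (g \<otimes> t)"
    using exchange_translate_exchange_tracked
      [OF J subgroups(2) I subgroups(1) stable(1) stable_closed Za(3)] by (elim bexE exE conjE)
  have "\<psi> (g \<otimes> t) = tracked P a' (g \<otimes> t)" if o: "orbit_map I J P \<psi>" "insert x Z \<subseteq> P" for P \<psi>
  proof -
    have "\<psi> g = tracked P a g"
      using Za(4) o by simp
    then show ?thesis
      using o x(3) stable(1) by (simp add: orbit_map_def)
  qed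
  then show ?case
    using Za(1,2) x(1,2) by (intro exI[of _ "insert x Z"] exI[of _ a']) simp
next
  case (stable_inv g)
  obtain Z a where Za: "finite Z" "Z \<subseteq> N \<inter> A" "g \<in> N <#> A \<longrightarrow> a \<in> A \<and> N #> a = N #> g"
    "\<forall>P \<psi>. orbit_map I J P \<psi> \<and> Z \<subseteq> P \<longrightarrow> \<psi> g = tracked P a g"
    using stable_inv(2) by (elim exE conjE)
  obtain x a' where x: "x \<in> N \<inter> A"
    "g \<otimes> inv t \<in> N <#> A \<longrightarrow> a' \<in> A \<and> N #> a' = N #> (g \<otimes> inv t)"
    "\<forall>P. coset_exchange G N P C I \<and> coset_exchange G N P D J \<and> x \<in> P \<longrightarrow>
      coset_exchange.exchange G N P D J
        (translate (inv t) (coset_exchange.exchange G N P C I (tracked P a g))) = tracked P a' (g \<otimes> inv t)"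
    using exchange_translate_exchange_tracked
      [OF I subgroups(1) J subgroups(2) stable_inv(1) inv_closed[OF stable_closed] Za(3)]
    by (elim bexE exE conjE)
  have "\<psi> (g \<otimes> inv t) = tracked P a' (g \<otimes> inv t)" if o: "orbit_map I J P \<psi>" "insert x Z \<subseteq> P" for P \<psi>
  proof -
    have "\<psi> g = tracked P a g"
      using Za(4) o by simp
    then show ?thesis
      using o x(3) stable_inv(1) by (simp add: orbit_map_def)
  qed
  then show ?case
    using Za(1,2) x(1,2) by (intro exI[of _ "insert x Z"] exI[of _ a']) simp
qed

text \<open>
  The subgroup \<open>P\<close> of the proof is generated by the finitely many elements that the two exchanges and
  the trajectories of generators of \<open>N\<close> require. Then \<open>N\<close> fixes the base point, and \<open>N \<inter> A\<close> can only
  do so by being contained in \<open>P\<close>.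
\<close>

lemma finitely_generated_inter_base:
  assumes fgN: "finitely_generated (G\<lparr>carrier := N\<rparr>)"
    and fgC: "finitely_generated (G\<lparr>carrier := N \<inter> C\<rparr>)"
    and fi: "finite_index G (N <#> C)"
  shows "finitely_generated (G\<lparr>carrier := N \<inter> A\<rparr>)"
proof -
  interpret A: subgroup A G by (rule subgroup_A)
  interpret C: subgroup C G by (rule subgroups)
  interpret D: subgroup D G by (rule subgroups)
  have NA: "subgroup (N \<inter> A) G" and NC: "subgroup (N \<inter> C) G"
    using subgroups_Inter_pair N.subgroup_axioms A.subgroup_axioms C.subgroup_axioms by auto
  obtain S where S: "finite S" "S \<subseteq> N" "generate G S = N"
    using fgN finitely_generated_subgroup_iff[OF N.subgroup_axioms] by auto
  obtain E where E: "finite E" "E \<subseteq> N \<inter> C" "generate G E = N \<inter> C"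
    using fgC finitely_generated_subgroup_iff[OF NC] by auto
  have Ec: "E \<subseteq> carrier G"
    using E(2) C.subset by blast
  obtain Q where Q: "finite Q" "Q \<subseteq> carrier G"
    "\<forall>g\<in>carrier G. \<exists>n\<in>N. \<exists>q\<in>Q. \<exists>c\<in>C. g = n \<otimes> q \<otimes> c"
    by (rule finite_index_set_multE[OF fi N.normal_axioms subgroups(4)])
  obtain I where I: "finite I" "transversal C I"
    by (rule transversal_exists[OF subgroups(4,1) Q])
  \<comment> \<open>As \<open>D = tCt\<^sup>-\<^sup>1\<close>, also \<open>ND\<close> has finite index.\<close>
  have "\<exists>n\<in>N. \<exists>q\<in>(\<lambda>q. q \<otimes> inv t) ` Q. \<exists>d\<in>D. g = n \<otimes> q \<otimes> d" if g: "g \<in> carrier G" for g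
  proof -
    obtain n q c where e: "n \<in> N" "q \<in> Q" "c \<in> C" "g \<otimes> t = n \<otimes> q \<otimes> c"
      using bspec[OF Q(3), of "g \<otimes> t"] g by auto
    then have qc: "q \<in> carrier G" using Q(2) by blast
    have "g = (g \<otimes> t) \<otimes> inv t"
      using g by (simp add: m_assoc)
    also have "\<dots> = n \<otimes> (q \<otimes> inv t) \<otimes> (t \<otimes> c \<otimes> inv t)"
      unfolding e(4) using e(1,3) qc by (simp add: m_assoc)
    finally have "g = n \<otimes> (q \<otimes> inv t) \<otimes> \<phi> c"
      using stable_conj[OF e(3)] by simp
    moreover have "\<phi> c \<in> D"
      using phi_image e(3) by blast
    ultimately show ?thesis
      using e(1,2) by blast
  qed
  then have QD: "\<forall>g\<in>carrier G. \<exists>n\<in>N. \<exists>q\<in>(\<lambda>q. q \<otimes> inv t) ` Q. \<exists>d\<in>D. g = n \<otimes> q \<otimes> d"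
    by (rule ballI)
  have QDc: "finite ((\<lambda>q. q \<otimes> inv t) ` Q)" "(\<lambda>q. q \<otimes> inv t) ` Q \<subseteq> carrier G"
    using Q(1,2) by auto
  obtain J where J: "finite J" "transversal D J"
    by (rule transversal_exists[OF subgroups(5,2) QDc QD])
  have IJ: "I \<subseteq> A" "J \<subseteq> A"
    using I(2) J(2) by (auto simp: transversal_def)
  \<comment> \<open>The conjugates of \<open>N \<inter> C\<close> by these elements are the groups \<open>N \<inter> iCi\<^sup>-\<^sup>1\<close> and \<open>N \<inter> jDj\<^sup>-\<^sup>1\<close>.\<close>
  define K where "K = I \<union> (\<lambda>j. j \<otimes> t) ` J"
  have Kc: "k \<in> carrier G" if "k \<in> K" for k
    using that IJ by (auto simp: K_def)
  define Z0 where "Z0 = (\<lambda>(k, z). k \<otimes> z \<otimes> inv k) ` (K \<times> E)"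
  have conj_in: "k \<otimes> z \<otimes> inv k \<in> N \<inter> A" if "k \<in> K" "z \<in> E" for k z
  proof -
    have z: "z \<in> N" "z \<in> C" "z \<in> carrier G" using that(2) E(2) by auto
    have "k \<otimes> z \<otimes> inv k \<in> N"
      by (rule N.inv_op_closed2[OF Kc[OF that(1)] z(1)])
    moreover have "k \<otimes> z \<otimes> inv k \<in> A"
    proof (cases "k \<in> I")
      case True
      then show ?thesis using IJ(1) z(2) subgroups(1) by auto
    next
      case False
      then have "k \<in> (\<lambda>j. j \<otimes> t) ` J"
        using that(1) by (simp add: K_def)
      then obtain j where j: "j \<in> J" "k = j \<otimes> t" by blast
      then have jA: "j \<in> A" using IJ(2) by blast
      have "k \<otimes> z \<otimes> inv k = j \<otimes> (t \<otimes> z \<otimes> inv t) \<otimes> inv j"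
        using j(2) jA z(3) by (simp add: inv_mult_group m_assoc)
      then show ?thesis
        using jA stable_conj[OF z(2)] phi_closed[OF z(2)] by simp
    qed
    ultimately show ?thesis by simp
  qed
  have Z0: "finite Z0" "Z0 \<subseteq> N \<inter> A"
  proof -
    show "finite Z0"
      unfolding Z0_def K_def using I(1) J(1) E(1) by simp
    show "Z0 \<subseteq> N \<inter> A"
      unfolding Z0_def using conj_in by (simp add: image_subset_iff split_paired_all)
  qed
  have "\<forall>s\<in>S. \<exists>p. finite (fst p) \<and> fst p \<subseteq> N \<inter> A \<and> (s \<in> N <#> A \<longrightarrow> snd p \<in> A \<and> N #> snd p = N #> s) \<and>
      (\<forall>P \<psi>. orbit_map I J P \<psi> \<and> fst p \<subseteq> P \<longrightarrow> \<psi> s = tracked P (snd p) s)"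
  proof
    fix s assume "s \<in> S"
    then have "s \<in> carrier G" using S(2) by auto
    from trajectory[OF I(2) J(2) this] obtain Z a where
      "finite Z \<and> Z \<subseteq> N \<inter> A \<and> (s \<in> N <#> A \<longrightarrow> a \<in> A \<and> N #> a = N #> s) \<and>
        (\<forall>P \<psi>. orbit_map I J P \<psi> \<and> Z \<subseteq> P \<longrightarrow> \<psi> s = tracked P a s)"
      by (elim exE)
    then show "\<exists>p. finite (fst p) \<and> fst p \<subseteq> N \<inter> A \<and> (s \<in> N <#> A \<longrightarrow> snd p \<in> A \<and> N #> snd p = N #> s) \<and>
      (\<forall>P \<psi>. orbit_map I J P \<psi> \<and> fst p \<subseteq> P \<longrightarrow> \<psi> s = tracked P (snd p) s)"
      by (intro exI[of _ "(Z, a)"]) simp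
  qed
  from bchoice[OF this] obtain p where p: "\<forall>s\<in>S. finite (fst (p s)) \<and> fst (p s) \<subseteq> N \<inter> A \<and>
      (s \<in> N <#> A \<longrightarrow> snd (p s) \<in> A \<and> N #> snd (p s) = N #> s) \<and>
      (\<forall>P \<psi>. orbit_map I J P \<psi> \<and> fst (p s) \<subseteq> P \<longrightarrow> \<psi> s = tracked P (snd (p s)) s)"
    by (rule exE)
  have S_rep: "s \<in> N <#> A" "snd (p s) \<in> N \<inter> A" if s: "s \<in> S" for s
  proof -
    have sN: "s \<in> N" using s S(2) by blast
    then show NA: "s \<in> N <#> A"
      using mem_set_multI[OF sN A.one_closed] by simp
    then have a: "snd (p s) \<in> A" "N #> snd (p s) = N #> s"
      using bspec[OF p s] by auto
    then have "snd (p s) \<otimes> inv s \<in> N"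
      using r_coset_eq_iff[OF N.subgroup_axioms, of "snd (p s)" s] sN by simp
    then have "snd (p s) \<otimes> inv s \<otimes> s \<in> N"
      using sN by (rule N.m_closed)
    then show "snd (p s) \<in> N \<inter> A"
      using a(1) sN by (simp add: m_assoc)
  qed
  define Z where "Z = Z0 \<union> (\<Union>s\<in>S. insert (snd (p s)) (fst (p s)))"
  have Z: "finite Z" "Z \<subseteq> N \<inter> A"
  proof -
    show "finite Z"
      unfolding Z_def using Z0(1) S(1) p by simp
    have "insert (snd (p s)) (fst (p s)) \<subseteq> N \<inter> A" if "s \<in> S" for s
      using S_rep(2)[OF that] bspec[OF p that] by simp
    then show "Z \<subseteq> N \<inter> A"
      unfolding Z_def using Z0(2) by (intro Un_least UN_least)
  qed
  have Zc: "Z \<subseteq> carrier G"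
    using Z(2) A.subset by blast
  let ?P = "generate G Z"
  interpret P: subgroup ?P G
    by (rule generate_is_subgroup[OF Zc])
  have P_sub: "?P \<subseteq> N \<inter> A"
    by (rule generate_subgroup_incl[OF Z(2) NA])
  have ZP: "z \<in> ?P" if "z \<in> Z" for z
    using that by (rule generate.incl)
  have conj_P: "k \<otimes> c \<otimes> inv k \<in> ?P" if k: "k \<in> K" and c: "c \<in> C" "c \<in> N" for k c
  proof (rule generate_conjugate[OF Ec Kc[OF k] P.subgroup_axioms])
    show "c \<in> generate G E" using E(3) c by simp
    fix z assume "z \<in> E"
    then have "k \<otimes> z \<otimes> inv k \<in> Z0"
      unfolding Z0_def using k by (intro image_eqI[of _ _ "(k, z)"]) simp_all
    then show "k \<otimes> z \<otimes> inv k \<in> ?P"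
      by (intro ZP) (simp add: Z_def)
  qed
  have EC: "coset_exchange G N ?P C I"
  proof (unfold_locales)
    show "?P \<subseteq> N" using P_sub by blast
    show "I \<subseteq> carrier G" using IJ(1) A.subset by blast
    show "i = j" if "i \<in> I" "j \<in> I" "b \<in> C" "b' \<in> C" "N #> (i \<otimes> b) = N #> (j \<otimes> b')" for i j b b'
      using that I(2) unfolding transversal_def by blast
    show "i \<otimes> b \<otimes> inv i \<in> ?P" if i: "i \<in> I" and b: "b \<in> C" and ib: "i \<otimes> b \<otimes> inv i \<in> N" for i b
    proof -
      have ic: "i \<in> carrier G" "b \<in> carrier G" using i b IJ(1) by auto
      have "inv i \<otimes> (i \<otimes> b \<otimes> inv i) \<otimes> i \<in> N"
        by (rule N.inv_op_closed1[OF ic(1) ib])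
      then have "b \<in> N"
        using ic by (simp add: m_assoc)
      then show ?thesis
        using i b by (intro conj_P) (auto simp: K_def)
    qed
  qed
  have ED: "coset_exchange G N ?P D J"
  proof (unfold_locales)
    show "?P \<subseteq> N" using P_sub by blast
    show "J \<subseteq> carrier G" using IJ(2) A.subset by blast
    show "i = j" if "i \<in> J" "j \<in> J" "b \<in> D" "b' \<in> D" "N #> (i \<otimes> b) = N #> (j \<otimes> b')" for i j b b'
      using that J(2) unfolding transversal_def by blast
    show "j \<otimes> d \<otimes> inv j \<in> ?P" if j: "j \<in> J" and d: "d \<in> D" and jd: "j \<otimes> d \<otimes> inv j \<in> N" for j d
    proof -
      have "d \<in> \<phi> ` C" using d phi_image by simp
      then obtain c where c: "c \<in> C" "d = \<phi> c" by blast
      have jc: "j \<in> carrier G" "c \<in> carrier G" using j c IJ(2) by auto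
      have eq: "j \<otimes> d \<otimes> inv j = (j \<otimes> t) \<otimes> c \<otimes> inv (j \<otimes> t)"
        unfolding c(2) stable_conj[OF c(1), symmetric] using jc by (simp add: inv_mult_group m_assoc)
      have "inv (j \<otimes> t) \<otimes> (j \<otimes> d \<otimes> inv j) \<otimes> (j \<otimes> t) \<in> N"
        using jc jd by (intro N.inv_op_closed1) auto
      then have "c \<in> N"
        unfolding eq using jc by (simp add: inv_mult_group m_assoc)
      then show ?thesis
        unfolding eq using j c(1) by (intro conj_P) (auto simp: K_def)
    qed
  qed
  interpret EC: coset_exchange G N ?P C I by (rule EC)
  obtain act where act:
    "\<forall>g\<in>carrier G. \<forall>\<omega>\<in>coset_pairs ?P N. act g \<omega> \<in> coset_pairs ?P N"
    "\<forall>g\<in>carrier G. \<forall>h\<in>carrier G. \<forall>\<omega>\<in>coset_pairs ?P N. act (g \<otimes> h) \<omega> = act h (act g \<omega>)"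
    "\<forall>\<omega>\<in>coset_pairs ?P N. act \<one> \<omega> = \<omega>"
    "\<forall>a\<in>A. \<forall>\<omega>\<in>coset_pairs ?P N. act a \<omega> = translate a \<omega>"
    "\<forall>\<omega>\<in>coset_pairs ?P N. act t \<omega> =
       coset_exchange.exchange G N ?P C I (translate t (coset_exchange.exchange G N ?P D J \<omega>))"
    "\<forall>\<omega>\<in>coset_pairs ?P N. act (inv t) \<omega> =
       coset_exchange.exchange G N ?P D J (translate (inv t) (coset_exchange.exchange G N ?P C I \<omega>))"
    by (rule exchange_action[OF EC ED])
  let ?o = "Inl ?P :: 'a set + 'a set"
  have o: "?o \<in> coset_pairs ?P N"
    using EC.coset_mem_cosets(1)[of \<one>] P.subset by simp
  have orbit: "orbit_map I J ?P (\<lambda>g. act g ?o)"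
    unfolding orbit_map_def
  proof (intro conjI ballI EC ED)
    show "act \<one> ?o = ?o" using act(3) o by (rule bspec)
    fix g assume g: "g \<in> carrier G"
    have og: "act g ?o \<in> coset_pairs ?P N"
      using act(1) g o by blast
    have mult: "act (g \<otimes> h) ?o = act h (act g ?o)" if "h \<in> carrier G" for h
      using act(2) g that o by blast
    show "act (g \<otimes> a) ?o = translate a (act g ?o)" if "a \<in> A" for a
      using mult[OF A.mem_carrier[OF that]] bspec[OF bspec[OF act(4) that] og] by (rule HOL.trans)
    show "act (g \<otimes> t) ?o = coset_exchange.exchange G N ?P C I
         (translate t (coset_exchange.exchange G N ?P D J (act g ?o)))"
      using mult[OF stable_closed] bspec[OF act(5) og] by (rule HOL.trans)
    show "act (g \<otimes> inv t) ?o = coset_exchange.exchange G N ?P D J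
         (translate (inv t) (coset_exchange.exchange G N ?P C I (act g ?o)))"
      using mult[OF inv_closed[OF stable_closed]] bspec[OF act(6) og] by (rule HOL.trans)
  qed
  have fix_S: "act s ?o = ?o" if s: "s \<in> S" for s
  proof -
    have "insert (snd (p s)) (fst (p s)) \<subseteq> Z"
      unfolding Z_def using s by blast
    then have sub: "snd (p s) \<in> ?P" "fst (p s) \<subseteq> ?P"
      using ZP by auto
    then have "act s ?o = tracked ?P (snd (p s)) s"
      using bspec[OF p s] orbit by blast
    then show ?thesis
      using S_rep(1)[OF s] P.rcos_const[OF group_axioms sub(1)] by (simp add: tracked_def)
  qed
  have fix_N: "act n ?o = ?o" if "n \<in> generate G S" for n
    using that
  proof (induction rule: generate.induct)
    case one
    show ?case using act(3) o by (rule bspec)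
  next
    case (incl s)
    then show ?case by (rule fix_S)
  next
    case (inv s)
    then have sc: "s \<in> carrier G" using S(2) by auto
    have "act (s \<otimes> inv s) ?o = act (inv s) (act s ?o)"
      using act(2) sc inv_closed[OF sc] o by blast
    then show ?case
      using fix_S[OF inv] sc bspec[OF act(3) o] by simp
  next
    case (eng m n)
    then have "m \<in> carrier G" "n \<in> carrier G" using S(3) by auto
    then have "act (m \<otimes> n) ?o = act n (act m ?o)"
      using act(2) o by blast
    then show ?case using eng by simp
  qed
  have "N \<inter> A \<subseteq> ?P"
  proof
    fix x assume x: "x \<in> N \<inter> A"
    then have "act x ?o = ?o"
      using fix_N S(3) by simp
    moreover have "act x ?o = translate x ?o"
      using act(4) x o by blast
    ultimately have "?P #> x = ?P"
      by simp
    moreover have "x \<in> ?P #> x"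
      using x by (intro rcos_self[OF _ P.subgroup_axioms]) simp
    ultimately show "x \<in> ?P" by simp
  qed
  then have "generate G Z = N \<inter> A"
    using P_sub by blast
  then show ?thesis
    using Z finitely_generated_subgroup_iff[OF NA] by blast
qed

end

theorem theorem2p2:
  fixes G :: "('a, 'b) monoid_scheme" (structure)
    and A C D N :: "'a set" and \<phi> :: "'a \<Rightarrow> 'a" and t :: 'a
  assumes "hnn_decomposition G A C D \<phi> t"
    and "N \<lhd> G"
  shows
    "(finitely_generated (G\<lparr>carrier := N\<rparr>) \<and> \<not> N \<subseteq> C \<longrightarrow>
       finite_index G (N <#> C) \<and>
       (finitely_generated (G\<lparr>carrier := N \<inter> C\<rparr>) \<longrightarrow>
        finitely_generated (G\<lparr>carrier := N \<inter> A\<rparr>))) \<and>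
     (finite_index G (N <#> C) \<longrightarrow>
       \<not> N \<subseteq> C \<and>
       (finitely_generated (G\<lparr>carrier := N \<inter> A\<rparr>) \<longrightarrow>
        finitely_generated (G\<lparr>carrier := N\<rparr>))) \<and>
     (finite_index G (N <#> C) \<longrightarrow>
       (finite (carrier (G Mod N)) \<longleftrightarrow>
        finite (carrier ((G\<lparr>carrier := C\<rparr>) Mod (N \<inter> C)))))"
proof -
  interpret hnn_normal_subgroup G A C D \<phi> t N
    by (rule hnn_normal_subgroup.intro[OF assms])
  show ?thesis
    using finite_index_if_finitely_generated finitely_generated_inter_base not_subset_if_finite_index
      finitely_generated_if_finite_index finite_quotient_iff by blast
qed

end
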